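(* Let $p$ be a prime, let $k$ be an algebraic extension of $\mathbb{F}_p$ and let $\Gamma$ be a totally ordered group such that $\mathbb{Z}\subseteq\Gamma\subseteq\mathbb{Q}$. Then there exists $\alpha\in\mathbb{C}_p$, transcendental over $\mathbb{Q}$, such that $\mathbb{Z}_{(p),\alpha}$ has residue field $k$ and value group $\Gamma$.
   Context: $\overline{\mathbb{Q}_p}$ is a fixed algebraic closure of $\mathbb{Q}_p$, $\mathbb{C}_p$ is its completion with respect to the unique extension of the $p$-adic valuation $v_p$ (with $v_p(p)=1$), and $\mathbb{O}_p$ is the valuation ring of $v_p$ on $\mathbb{C}_p$. For $\alpha\in\mathbb{C}_p$, $\mathbb{Z}_{(p),\alpha}=\{\phi\in\mathbb{Q}(X)\mid\phi(\alpha)\in\mathbb{O}_p\}$, a valuation domain of $\mathbb{Q}(X)$ extending $\mathbb{Z}_{(p)}$; for $\alpha$ transcendental over $\mathbb{Q}$ its valuation is $\phi\mapsto v_p(\phi(\alpha))$, so its value group is a subgroup of $\mathbb{Q}$ containing $\mathbb{Z}$. "Has residue field $k$" means the residue field is isomorphic to $k$ over $\mathbb{F}_p$. *)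

theory Defs
  imports
    "HOL-Analysis.Abstract_Metric_Spaces"
    "HOL-Algebra.Algebraic_Closure_Type"
    "HOL-Algebra.IntRing"
    "HOL-Computational_Algebra.Computational_Algebra"
    "HOL-Computational_Algebra.Field_as_Ring"
begin

text \<open>
  Valuations are functions into the reals; the value infinity at 0 is not represented, and the
  value \<open>v 0\<close> is never used.
\<close>

locale valued_field =
  fixes v :: "'a::field \<Rightarrow> real"
  assumes val_mult: "\<lbrakk>x \<noteq> 0; y \<noteq> 0\<rbrakk> \<Longrightarrow> v (x * y) = v x + v y"
    and val_add: "\<lbrakk>x \<noteq> 0; y \<noteq> 0; x + y \<noteq> 0\<rbrakk> \<Longrightarrow> min (v x) (v y) \<le> v (x + y)"

definition integral_elts :: "('a::field \<Rightarrow> real) \<Rightarrow> 'a set" where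
  "integral_elts v = {x. x = 0 \<or> 0 \<le> v x}"

definition val_dist :: "('a::field \<Rightarrow> real) \<Rightarrow> 'a \<Rightarrow> 'a \<Rightarrow> real" where
  "val_dist v x y = (if x = y then 0 else exp (- v (x - y)))"

lemma (in valued_field) Metric_space_val_dist: "Metric_space S (val_dist v)"
proof
  have v1: "v 1 = 0" using val_mult[of 1 1] by simp
  have "v (-1) = 0" using val_mult[of "-1" "-1"] v1 by simp
  then have vm: "v (- x) = v x" if "x \<noteq> 0" for x using val_mult[of "-1" x] that by simp
  show "val_dist v x y = val_dist v y x" for x y
    using vm[of "x - y"] by (auto simp: val_dist_def)
  show "val_dist v x z \<le> val_dist v x y + val_dist v y z" for x y z
  proof (cases "x = y \<or> y = z \<or> x = z")
    case False
    then have "min (v (x - y)) (v (y - z)) \<le> v (x - z)"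
      using val_add[of "x - y" "y - z"] by simp
    then have "exp (- v (x - z)) \<le> exp (- v (x - y)) \<or> exp (- v (x - z)) \<le> exp (- v (y - z))"
      by auto
    then show ?thesis using False
      by (auto simp: val_dist_def intro: add_increasing add_increasing2)
  qed (auto simp: val_dist_def)
qed (auto simp: val_dist_def)

text \<open>\<open>K\<close> is a completion of its subset \<open>F\<close>, both carrying the restriction of \<open>v\<close>.\<close>

definition is_completion :: "('a::field \<Rightarrow> real) \<Rightarrow> 'a set \<Rightarrow> 'a set \<Rightarrow> bool" where
  "is_completion v F K \<longleftrightarrow>
     F \<subseteq> K \<and> Metric_space.mcomplete K (val_dist v) \<and>
     Metric_space.mtopology K (val_dist v) closure_of F = K"

definition padic_val_rat :: "nat \<Rightarrow> rat \<Rightarrow> int" where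
  "padic_val_rat p q =
     int (multiplicity (int p) (fst (quotient_of q))) - int (multiplicity (int p) (snd (quotient_of q)))"

text \<open>
  The type \<open>'c\<close> with the valuation \<open>v\<close> is \<open>\<complex>\<^sub>p\<close>: \<open>Qp\<close> is a completion of the rationals with the
  \<open>p\<close>-adic valuation, \<open>Qpbar\<close> is an algebraic closure of \<open>Qp\<close>, and \<open>'c\<close> is a completion of
  \<open>Qpbar\<close>. Everything is determined up to isomorphism by these conditions; that \<open>Qp\<close> and \<open>Qpbar\<close>
  are subfields is part of \<^locale>\<open>algebraic_closure\<close>.
\<close>

locale padic_complex_field = valued_field v
  for p :: nat and v :: "'c::field_char_0 \<Rightarrow> real" and Qp Qpbar :: "'c set" +
  assumes prime_p: "prime p"
    and val_of_rat: "q \<noteq> 0 \<Longrightarrow> v (of_rat q) = of_int (padic_val_rat p q)"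
    and completion_Qp: "is_completion v \<rat> Qp"
    and closure_Qpbar: "algebraic_closure (ring_of_type_algebra\<lparr>carrier := Qpbar\<rparr>) Qp"
    and completion_Cp: "is_completion v Qpbar UNIV"

text \<open>Value at \<open>\<alpha>\<close> of a rational function written in lowest terms, wherever it has no pole.\<close>

definition ratfun_defined_at :: "rat poly fract \<Rightarrow> 'c::field_char_0 \<Rightarrow> bool" where
  "ratfun_defined_at \<phi> \<alpha> \<longleftrightarrow> poly (map_poly of_rat (snd (quot_of_fract \<phi>))) \<alpha> \<noteq> 0"

definition ratfun_eval :: "rat poly fract \<Rightarrow> 'c::field_char_0 \<Rightarrow> 'c" where
  "ratfun_eval \<phi> \<alpha> =
     poly (map_poly of_rat (fst (quot_of_fract \<phi>))) \<alpha> / poly (map_poly of_rat (snd (quot_of_fract \<phi>))) \<alpha>"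

definition val_ring_at :: "('c::field_char_0 \<Rightarrow> real) \<Rightarrow> 'c \<Rightarrow> rat poly fract ring" where
  "val_ring_at v \<alpha> = ring_of_type_algebra
     \<lparr>carrier := {\<phi>. ratfun_defined_at \<phi> \<alpha> \<and> ratfun_eval \<phi> \<alpha> \<in> integral_elts v}\<rparr>"

text \<open>Meaningful for \<open>\<alpha>\<close> transcendental over the rationals, when \<open>\<phi> \<noteq> 0\<close> implies \<open>\<phi>(\<alpha>) \<noteq> 0\<close>.\<close>

definition value_group_at :: "('c::field_char_0 \<Rightarrow> real) \<Rightarrow> 'c \<Rightarrow> real set" where
  "value_group_at v \<alpha> = {v (ratfun_eval \<phi> \<alpha>) |\<phi>. \<phi> \<noteq> 0}"

text \<open>For a local ring, whose maximal ideal consists of the non-units.\<close>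

definition residue_field :: "('a, 'm) ring_scheme \<Rightarrow> 'a set ring" where
  "residue_field V = V Quot (carrier V - Units V)"

text \<open>
  The subfield \<open>F\<close> is necessarily the prime field of \<open>k\<close>, so every ring isomorphism onto \<open>k\<close> is one
  over \<open>F\<close>.
\<close>

definition algebraic_extension_of_Fp :: "nat \<Rightarrow> 'k set \<Rightarrow> ('k, 'm) ring_scheme \<Rightarrow> bool" where
  "algebraic_extension_of_Fp p F k \<longleftrightarrow>
     field k \<and> subfield F k \<and> k\<lparr>carrier := F\<rparr> \<simeq> ZFact (int p) \<and>
     (\<forall>x \<in> carrier k. (ring.algebraic k over F) x)"

end

theory Submission
  imports Defs
begin

text \<open>
  Work with the absolute value \<open>nabs x = exp (- v x)\<close> on \<open>\<complex>\<^sub>p\<close>. Zorn's lemma, applied to pairs of a ring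
  \<open>L\<close> of algebraic numbers with values in \<open>\<Gamma>\<close> and a homomorphism from its integral elements to \<open>k\<close> whose
  kernel is the set of elements of positive valuation, yields a pair \<open>L\<close> with value group \<open>\<Gamma>\<close> and
  residue field \<open>k\<close>: a missing residue is obtained by adjoining a root of a lift of its minimal
  polynomial, a missing value \<open>\<gamma>\<close> by adjoining an \<open>m\<close>-th root, where \<open>m\<close> is the order of \<open>\<gamma>\<close> modulo the
  values of \<open>L\<close>.

  Enumerate \<open>L - {0}\<close> as \<open>b\<^sub>0, b\<^sub>1, \<dots>\<close> and put \<open>\<alpha> = \<Sum>\<^sub>i p ^ N\<^sub>i * b\<^sub>i\<close> with rapidly growing \<open>N\<^sub>i\<close>. As \<open>\<alpha>\<close> is a
  limit of elements of \<open>L\<close>, the field \<open>\<rat>(\<alpha>)\<close> has no values or residues other than those of \<open>L\<close>. Conversely,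
  if \<open>f \<in> \<rat>[X]\<close> has a simple root at the \<open>i\<close>-th partial sum, then \<open>f(\<alpha>) / (p ^ N\<^sub>i * f'(\<alpha>))\<close>
  equals \<open>b\<^sub>i\<close> up to a factor congruent to 1, so every value and residue of \<open>L\<close> occurs in \<open>\<rat>(\<alpha>)\<close>.
\<close>

subsection \<open>Subrings and polynomials over them\<close>

text \<open>Each extension step must enlarge one invariant and leave the other alone. Any root
  serves in both steps: the valuation is already given on the whole field, and minimality (of the
  lifted polynomial, respectively of \<open>m\<close>) determines it on all remainders of smaller
  degree. Algebraicity of \<open>k\<close> enters as torsion: each nonzero residue is a root of
  unity, so a power of a unit is congruent to its inverse. Together with a partner \<open>y\<close>
  satisfying \<open>nabs (x * y) = 1\<close> for each nonzero \<open>x\<close>, this lets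
  \<open>L\<close> be treated as a ring throughout. Algebraic numbers are used because they are
  countable, so that one series has room for a multiple of every element of \<open>L\<close> and can
  also be steered away from every algebraic number. The scaling factors are powers of
  \<open>p\<close> because these are rational: they make the terms as small as desired and can be
  divided out again inside \<rat>(\<alpha>).\<close>

definition subring_set :: "'a::comm_ring_1 set \<Rightarrow> bool" where
  "subring_set A \<longleftrightarrow> 1 \<in> A \<and> (\<forall>x\<in>A. \<forall>y\<in>A. x - y \<in> A \<and> x * y \<in> A)"

lemma subring_setD:
  assumes "subring_set A"
  shows subring_set_1: "1 \<in> A"
    and subring_set_0: "0 \<in> A"
    and subring_set_diff: "x \<in> A \<Longrightarrow> y \<in> A \<Longrightarrow> x - y \<in> A"
    and subring_set_uminus: "x \<in> A \<Longrightarrow> - x \<in> A"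
    and subring_set_add: "x \<in> A \<Longrightarrow> y \<in> A \<Longrightarrow> x + y \<in> A"
    and subring_set_mult: "x \<in> A \<Longrightarrow> y \<in> A \<Longrightarrow> x * y \<in> A"
proof -
  show 1: "1 \<in> A" using assms by (simp add: subring_set_def)
  show diff: "x - y \<in> A" if "x \<in> A" "y \<in> A" for x y
    using assms that by (auto simp: subring_set_def)
  show "x * y \<in> A" if "x \<in> A" "y \<in> A" for x y
    using assms that by (auto simp: subring_set_def)
  show 0: "0 \<in> A" using diff[OF 1 1] by simp
  show um: "- x \<in> A" if "x \<in> A" for x using diff[OF 0 that] by simp
  show "x + y \<in> A" if "x \<in> A" "y \<in> A" for x y using diff[OF that(1) um[OF that(2)]] by simp
qed

lemma subring_set_power: "subring_set A \<Longrightarrow> x \<in> A \<Longrightarrow> x ^ n \<in> A"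
  by (induction n) (auto intro: subring_set_1 subring_set_mult)

lemma subring_set_sum:
  "subring_set A \<Longrightarrow> (\<And>i. i \<in> I \<Longrightarrow> f i \<in> A) \<Longrightarrow> sum f I \<in> A"
  by (induction I rule: infinite_finite_induct) (auto intro: subring_set_0 subring_set_add)

definition poly_over :: "'a::zero set \<Rightarrow> 'a poly set" where
  "poly_over A = {G. \<forall>i. coeff G i \<in> A}"

lemma poly_over_mono: "A \<subseteq> B \<Longrightarrow> G \<in> poly_over A \<Longrightarrow> G \<in> poly_over B"
  by (auto simp: poly_over_def)

lemma poly_over_0: "0 \<in> A \<Longrightarrow> 0 \<in> poly_over A"
  by (simp add: poly_over_def)

lemma poly_over_pCons_iff: "pCons c G \<in> poly_over A \<longleftrightarrow> c \<in> A \<and> G \<in> poly_over A"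
proof
  assume "pCons c G \<in> poly_over A"
  then have "coeff (pCons c G) 0 \<in> A" "coeff (pCons c G) (Suc i) \<in> A" for i
    unfolding poly_over_def by blast+
  then show "c \<in> A \<and> G \<in> poly_over A" by (simp add: poly_over_def)
next
  assume "c \<in> A \<and> G \<in> poly_over A"
  then show "pCons c G \<in> poly_over A" by (simp add: poly_over_def coeff_pCons split: nat.split)
qed

lemma poly_over_monom: "0 \<in> A \<Longrightarrow> c \<in> A \<Longrightarrow> monom c n \<in> poly_over A"
  by (simp add: poly_over_def)

context
  fixes A :: "'a::comm_ring_1 set"
  assumes A: "subring_set A"
begin

lemma poly_over_diff: "G \<in> poly_over A \<Longrightarrow> H \<in> poly_over A \<Longrightarrow> G - H \<in> poly_over A"
  by (auto simp: poly_over_def intro: subring_set_diff[OF A])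

lemma poly_over_add: "G \<in> poly_over A \<Longrightarrow> H \<in> poly_over A \<Longrightarrow> G + H \<in> poly_over A"
  by (auto simp: poly_over_def intro: subring_set_add[OF A])

lemma poly_over_mult: "G \<in> poly_over A \<Longrightarrow> H \<in> poly_over A \<Longrightarrow> G * H \<in> poly_over A"
  by (auto simp: poly_over_def coeff_mult intro!: subring_set_sum[OF A] subring_set_mult[OF A])

lemma poly_over_smult: "c \<in> A \<Longrightarrow> G \<in> poly_over A \<Longrightarrow> smult c G \<in> poly_over A"
  by (auto simp: poly_over_def intro: subring_set_mult[OF A])

lemma subring_set_poly_over: "subring_set (poly_over A)"
  by (auto simp: subring_set_def poly_over_diff poly_over_mult)
     (auto simp: poly_over_def coeff_1 intro: subring_set_0[OF A] subring_set_1[OF A])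

lemma poly_over_eval: "G \<in> poly_over A \<Longrightarrow> x \<in> A \<Longrightarrow> poly G x \<in> A"
  by (induction G)
     (auto simp: poly_over_pCons_iff intro: subring_set_0[OF A] subring_set_add[OF A] subring_set_mult[OF A])

end

text \<open>A monic divisor cancels leading terms without inverses, so a subring suffices. As the
  zero polynomial has degree 0, \<open>degree F > 0\<close> lets a zero remainder count as one of
  smaller degree.\<close>

lemma poly_over_monic_division:
  fixes F :: "'a::comm_ring_1 poly"
  assumes A: "subring_set A" and F: "F \<in> poly_over A" "lead_coeff F = 1" and "degree F > 0"
    and G: "G \<in> poly_over A"
  shows "\<exists>Q\<in>poly_over A. \<exists>R\<in>poly_over A. G = Q * F + R \<and> degree R < degree F"
  using G
proof (induction "degree G" arbitrary: G rule: less_induct)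
  case less
  show ?case
  proof (cases "degree G < degree F")
    case True
    then show ?thesis
      using less.prems poly_over_0[OF subring_set_0[OF A]] by (intro bexI[of _ 0] bexI[of _ G]) auto
  next
    case False
    define P where "P = monom (lead_coeff G) (degree G - degree F)"
    have P: "P \<in> poly_over A"
      unfolding P_def using less.prems by (intro poly_over_monom subring_set_0[OF A]) (simp add: poly_over_def)
    have PF: "coeff (P * F) (degree G) = lead_coeff G"
      using False F(2) by (simp add: P_def coeff_monom_mult)
    have "degree (P * F) \<le> degree G"
      using degree_mult_le[of P F] degree_monom_le[of "lead_coeff G" "degree G - degree F"] False
      by (simp add: P_def)
    then have "degree (G - P * F) \<le> degree G" by (simp add: degree_diff_le)
    moreover have "degree (G - P * F) \<noteq> degree G"
    proof
      assume eq: "degree (G - P * F) = degree G"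
      have "coeff (G - P * F) (degree G) = 0" using PF by simp
      then have "G - P * F = 0" by (metis eq leading_coeff_0_iff)
      then show False using eq False \<open>degree F > 0\<close> by simp
    qed
    ultimately have deg: "degree (G - P * F) < degree G" by simp
    have "G - P * F \<in> poly_over A"
      by (intro poly_over_diff poly_over_mult A less.prems P F)
    from less.hyps[OF deg this] obtain Q R where QR: "Q \<in> poly_over A" "R \<in> poly_over A"
      "G - P * F = Q * F + R" "degree R < degree F" by auto
    have "G = (P + Q) * F + R" using QR(3) by (simp add: algebra_simps)
    then show ?thesis using QR poly_over_add[OF A P QR(1)] by blast
  qed
qed

definition adjoin :: "'a::comm_ring_1 set \<Rightarrow> 'a \<Rightarrow> 'a set" where
  "adjoin A x = (\<lambda>G. poly G x) ` poly_over A"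

lemma subring_set_adjoin:
  assumes A: "subring_set A" shows "subring_set (adjoin A x)"
  unfolding subring_set_def adjoin_def
proof (intro conjI ballI)
  show "1 \<in> (\<lambda>G. poly G x) ` poly_over A"
    using subring_set_1[OF subring_set_poly_over[OF A]] by (auto intro!: image_eqI[of _ _ 1])
next
  fix a b assume "a \<in> (\<lambda>G. poly G x) ` poly_over A" "b \<in> (\<lambda>G. poly G x) ` poly_over A"
  then obtain G H where *: "G \<in> poly_over A" "H \<in> poly_over A" "a = poly G x" "b = poly H x" by auto
  show "a - b \<in> (\<lambda>G. poly G x) ` poly_over A"
    using * poly_over_diff[OF A *(1,2)] by (auto intro!: image_eqI[of _ _ "G - H"])
  show "a * b \<in> (\<lambda>G. poly G x) ` poly_over A"
    using * poly_over_mult[OF A *(1,2)] by (auto intro!: image_eqI[of _ _ "G * H"])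
qed

lemma subset_adjoin:
  assumes A: "subring_set A" shows "A \<subseteq> adjoin A x"
proof
  fix a assume "a \<in> A"
  then have "[:a:] \<in> poly_over A"
    by (simp add: poly_over_pCons_iff poly_over_0 subring_set_0[OF A])
  then show "a \<in> adjoin A x" unfolding adjoin_def by (rule image_eqI[rotated]) simp
qed

lemma in_adjoin:
  assumes A: "subring_set A" shows "x \<in> adjoin A x"
proof -
  have "[:0, 1:] \<in> poly_over A"
    by (simp add: poly_over_pCons_iff poly_over_0 subring_set_0[OF A] subring_set_1[OF A])
  then show ?thesis unfolding adjoin_def by (rule image_eqI[rotated]) simp
qed

lemma adjoin_minimal:
  assumes "subring_set B" "A \<subseteq> B" "x \<in> B"
  shows "adjoin A x \<subseteq> B"
  using poly_over_eval[OF assms(1) poly_over_mono[OF assms(2)] assms(3)] by (auto simp: adjoin_def)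

text \<open>Both extension steps read the values and residues of the enlarged ring off these
  representatives of small degree.\<close>

lemma adjoin_reduce:
  assumes A: "subring_set A" and F: "F \<in> poly_over A" "lead_coeff F = 1" "degree F > 0" "poly F x = 0"
    and z: "z \<in> adjoin A x"
  shows "\<exists>R\<in>poly_over A. degree R < degree F \<and> z = poly R x"
proof -
  obtain G where G: "G \<in> poly_over A" "z = poly G x" using z by (auto simp: adjoin_def)
  obtain Q R where "R \<in> poly_over A" "G = Q * F + R" "degree R < degree F"
    using poly_over_monic_division[OF A F(1-3) G(1)] by blast
  then show ?thesis using G F(4) by auto
qed

subsection \<open>Absolute values and residue relations\<close>

context valued_field
begin

text \<open>In multiplicative form 0 is an ordinary element of absolute value 0, whereas
  \<open>v 0\<close> carries no meaning.\<close>

definition nabs :: "'a \<Rightarrow> real" where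
  "nabs x = val_dist v x 0"

lemma nabs_eq: "x \<noteq> 0 \<Longrightarrow> nabs x = exp (- v x)"
  by (simp add: nabs_def val_dist_def)

lemma nabs_0 [simp]: "nabs 0 = 0"
  by (simp add: nabs_def val_dist_def)

lemma nabs_nonneg [simp]: "0 \<le> nabs x"
  by (simp add: nabs_def val_dist_def)

lemma nabs_eq_0_iff [simp]: "nabs x = 0 \<longleftrightarrow> x = 0"
  by (simp add: nabs_def val_dist_def)

lemma nabs_pos_iff [simp]: "0 < nabs x \<longleftrightarrow> x \<noteq> 0"
  by (simp add: nabs_def val_dist_def)

lemma val_dist_eq: "val_dist v x y = nabs (x - y)"
  by (simp add: nabs_def val_dist_def)

lemma nabs_mult: "nabs (x * y) = nabs x * nabs y"
  by (cases "x = 0 \<or> y = 0") (auto simp: nabs_eq val_mult mult_exp_exp)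

lemma nabs_1 [simp]: "nabs 1 = 1"
  using nabs_mult[of 1 1] by simp

lemma nabs_minus [simp]: "nabs (- x) = nabs x"
proof -
  have "(nabs (- 1))\<^sup>2 = 1" using nabs_mult[of "- 1" "- 1"] by (simp add: power2_eq_square)
  then have "nabs (- 1) = 1" using nabs_nonneg[of "- 1"] by (simp add: power2_eq_1_iff)
  then show ?thesis using nabs_mult[of "- 1" x] by simp
qed

lemma nabs_diff_commute: "nabs (x - y) = nabs (y - x)"
  using nabs_minus[of "x - y"] by simp

lemma nabs_power: "nabs (x ^ n) = nabs x ^ n"
  by (induction n) (auto simp: nabs_mult)

lemma nabs_add: "nabs (x + y) \<le> max (nabs x) (nabs y)"
proof (cases "x = 0 \<or> y = 0 \<or> x + y = 0")
  case False
  then show ?thesis using val_add[of x y] by (auto simp: nabs_eq max_def min_def split: if_splits)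
qed (auto simp: le_max_iff_disj)

lemma nabs_diff: "nabs (x - y) \<le> max (nabs x) (nabs y)"
  using nabs_add[of x "- y"] by simp

lemma nabs_add_less: "nabs x < c \<Longrightarrow> nabs y < c \<Longrightarrow> nabs (x + y) < c"
  using nabs_add[of x y] by linarith

lemma nabs_add_le: "nabs x \<le> c \<Longrightarrow> nabs y \<le> c \<Longrightarrow> nabs (x + y) \<le> c"
  using nabs_add[of x y] by linarith

lemma nabs_diff_less: "nabs x < c \<Longrightarrow> nabs y < c \<Longrightarrow> nabs (x - y) < c"
  using nabs_diff[of x y] by linarith

lemma nabs_diff_trans_less: "nabs (x - y) < c \<Longrightarrow> nabs (y - z) < c \<Longrightarrow> nabs (x - z) < c"
  using nabs_add_less[of "x - y" c "y - z"] by simp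

text \<open>The ultrametric isosceles principle; the hypothesis says that \<open>x / y\<close> is
  congruent to 1. Approximations that have to preserve values are stated in this relative
  form.\<close>

lemma nabs_eqI: "nabs (x - y) < nabs y \<Longrightarrow> nabs x = nabs y"
  using nabs_add[of "x - y" y] nabs_diff[of x "x - y"] by simp

lemma nabs_sum_le: "0 \<le> c \<Longrightarrow> (\<And>i. i \<in> I \<Longrightarrow> nabs (f i) \<le> c) \<Longrightarrow> nabs (sum f I) \<le> c"
  by (induction I rule: infinite_finite_induct) (auto intro: nabs_add_le)

lemma nabs_sum_less: "0 < c \<Longrightarrow> (\<And>i. i \<in> I \<Longrightarrow> nabs (f i) < c) \<Longrightarrow> nabs (sum f I) < c"
  by (induction I rule: infinite_finite_induct) (auto intro: nabs_add_less)

lemma nabs_poly_le: "(\<And>i. nabs (coeff G i) \<le> 1) \<Longrightarrow> nabs x \<le> 1 \<Longrightarrow> nabs (poly G x) \<le> 1"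
  unfolding poly_altdef by (rule nabs_sum_le) (auto simp: nabs_mult nabs_power intro!: mult_le_one power_le_one)

lemma nabs_poly_less: 
  assumes "\<And>i. nabs (coeff G i) < 1" "nabs x \<le> 1" shows "nabs (poly G x) < 1"
  unfolding poly_altdef
proof (rule nabs_sum_less)
  fix i
  have "nabs (coeff G i) * nabs x ^ i \<le> nabs (coeff G i) * 1"
    using assms(2) by (intro mult_left_mono power_le_one) auto
  then show "nabs (coeff G i * x ^ i) < 1" using assms(1)[of i] by (simp add: nabs_mult nabs_power)
qed simp

text \<open>A root of larger absolute value would make the leading term dominate.\<close>

lemma nabs_integral_root:
  assumes coeffs: "\<And>i. nabs (coeff F i) \<le> 1" and "lead_coeff F = 1" "degree F > 0" and root: "poly F x = 0"
  shows "nabs x \<le> 1"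
proof (rule ccontr)
  assume "\<not> nabs x \<le> 1"
  then have x: "nabs x > 1" by simp
  then have "x \<noteq> 0" by auto
  define n where "n = degree F"
  have "poly F x = (\<Sum>i<n. coeff F i * x ^ i) + x ^ n"
    unfolding poly_altdef using assms(2) by (simp add: n_def lessThan_Suc_atMost[symmetric])
  then have "nabs (x ^ n) = nabs (\<Sum>i<n. coeff F i * x ^ i)"
    using root by (metis add_eq_0_iff nabs_minus)
  also have "\<dots> < nabs (x ^ n)"
  proof (rule nabs_sum_less)
    fix i assume "i \<in> {..<n}"
    have "nabs (coeff F i) * nabs x ^ i \<le> 1 * nabs x ^ i"
      using coeffs[of i] by (intro mult_right_mono) auto
    also have "\<dots> < nabs x ^ n" using x \<open>i \<in> {..<n}\<close> by (simp add: power_strict_increasing)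
    finally show "nabs (coeff F i * x ^ i) < nabs (x ^ n)" by (simp add: nabs_mult nabs_power)
  qed (use \<open>x \<noteq> 0\<close> in simp)
  finally show False by simp
qed

text \<open>The largest term dominates all others. Zero terms are exempt from distinctness, since
  several coefficients of a remainder may vanish.\<close>

lemma nabs_sum_distinct:
  assumes "finite I" and distinct: "\<And>i j. i \<in> I \<Longrightarrow> j \<in> I \<Longrightarrow> i \<noteq> j \<Longrightarrow> f i \<noteq> 0 \<Longrightarrow> f j \<noteq> 0 \<Longrightarrow> nabs (f i) \<noteq> nabs (f j)"
    and "\<exists>i\<in>I. f i \<noteq> 0"
  shows "\<exists>i\<in>I. f i \<noteq> 0 \<and> nabs (sum f I) = nabs (f i) \<and> (\<forall>j\<in>I. nabs (f j) \<le> nabs (f i))"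
  using assms
proof (induction I)
  case (insert a I)
  consider "f a = 0" | "f a \<noteq> 0" "\<forall>i\<in>I. f i = 0" | "f a \<noteq> 0" "\<exists>i\<in>I. f i \<noteq> 0" by blast
  then show ?case
  proof cases
    case 1
    then have "\<exists>i\<in>I. f i \<noteq> 0 \<and> nabs (sum f I) = nabs (f i) \<and> (\<forall>j\<in>I. nabs (f j) \<le> nabs (f i))"
      using insert.prems by (intro insert.IH) auto
    then show ?thesis using 1 insert.hyps by auto
  next
    case 2
    then show ?thesis using insert.hyps by auto
  next
    case 3
    then have "\<exists>i\<in>I. f i \<noteq> 0 \<and> nabs (sum f I) = nabs (f i) \<and> (\<forall>j\<in>I. nabs (f j) \<le> nabs (f i))"
      using insert.prems by (intro insert.IH) auto
    then obtain i where i: "i \<in> I" "f i \<noteq> 0" "nabs (sum f I) = nabs (f i)" "\<forall>j\<in>I. nabs (f j) \<le> nabs (f i)"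
      by blast
    then have "nabs (f a) \<noteq> nabs (f i)" using insert.prems(1)[of a i] insert.hyps 3 by auto
    then consider "nabs (f a) < nabs (f i)" | "nabs (f i) < nabs (f a)" by linarith
    then show ?thesis
    proof cases
      case 1
      then have "nabs (sum f (insert a I)) = nabs (f i)"
        using nabs_eqI[of "f a + sum f I" "sum f I"] i insert.hyps by simp
      then show ?thesis using i 1 by auto
    next
      case 2
      then have "nabs (sum f (insert a I)) = nabs (f a)"
        using nabs_eqI[of "f a + sum f I" "f a"] i insert.hyps by simp
      then show ?thesis using i 2 3 by force
    qed
  qed
qed auto

end

text \<open>
  \<open>S\<close> is the graph of a ring homomorphism; with graphs in place of functions, the union of a chain
  of such homomorphisms needs no construction.
\<close>

locale residue_relation = valued_field v + k: field k
  for v :: "'a::field \<Rightarrow> real" and k :: "('k, 'm) ring_scheme" (structure) +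
  fixes S :: "('a \<times> 'k) set"
  assumes rel_carrier: "(x, s) \<in> S \<Longrightarrow> s \<in> carrier k"
    and rel_integral: "(x, s) \<in> S \<Longrightarrow> nabs x \<le> 1"
    and rel_zero_iff: "(x, s) \<in> S \<Longrightarrow> s = \<zero> \<longleftrightarrow> nabs x < 1"
    and rel_one: "(1, \<one>) \<in> S"
    and rel_diff: "(x, s) \<in> S \<Longrightarrow> (y, t) \<in> S \<Longrightarrow> (x - y, s \<ominus> t) \<in> S"
    and rel_mult: "(x, s) \<in> S \<Longrightarrow> (y, t) \<in> S \<Longrightarrow> (x * y, s \<otimes> t) \<in> S"
begin

lemma rel_zero: "(0, \<zero>) \<in> S"
  using rel_diff[OF rel_one rel_one] by (simp add: k.minus_eq k.r_neg)

lemma rel_uminus: "(x, s) \<in> S \<Longrightarrow> (- x, \<ominus> s) \<in> S"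
  using rel_diff[OF rel_zero] rel_carrier by (fastforce simp: k.minus_eq)

lemma rel_add: "(x, s) \<in> S \<Longrightarrow> (y, t) \<in> S \<Longrightarrow> (x + y, s \<oplus> t) \<in> S"
  using rel_diff[of x s "- y" "\<ominus> t"] rel_uminus[of y t] rel_carrier by (simp add: k.minus_eq)

lemma rel_power: "(x, s) \<in> S \<Longrightarrow> (x ^ n, s [^] n) \<in> S"
proof (induction n)
  case (Suc n)
  then show ?case using rel_mult[of "x ^ n" "s [^] n" x s] by (simp add: mult.commute)
qed (simp add: rel_one)

text \<open>The residue of \<open>x - y\<close> is \<open>s \<ominus> t\<close>. The case
  \<open>x = y\<close> shows that the relation is single-valued.\<close>

lemma rel_unique:
  assumes "(x, s) \<in> S" "(y, t) \<in> S" "nabs (x - y) < 1"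
  shows "s = t"
proof -
  have "s \<ominus> t = \<zero>" using rel_zero_iff[OF rel_diff[OF assms(1,2)]] assms(3) by simp
  then show ?thesis using rel_carrier assms by (metis k.r_right_minus_eq)
qed

lemma subring_set_Domain: "subring_set (Domain S)"
  unfolding subring_set_def using rel_one rel_diff rel_mult by (blast intro: DomainI)

end

context valued_field begin

text \<open>Extends the residue map along congruence, keeping the set of residues. This covers every
  enlargement that brings no new residue: from integers to rationals, in the value step, and finally
  to values of rational functions.\<close>

definition saturate :: "'a set \<Rightarrow> ('a \<times> 'k) set \<Rightarrow> ('a \<times> 'k) set" where
  "saturate A S = {(x, s). x \<in> A \<and> (\<exists>y. (y, s) \<in> S \<and> nabs (x - y) < 1)}"

end

lemma (in residue_relation) residue_relation_saturate:
  assumes A: "subring_set A"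
  shows "residue_relation v k (saturate A S)"
proof
  fix x y s t assume "(x, s) \<in> saturate A S"
  then obtain x' where x: "x \<in> A" "(x', s) \<in> S" "nabs (x - x') < 1" by (auto simp: saturate_def)
  show "s \<in> carrier k" using x rel_carrier by auto
  have le: "nabs x \<le> 1" using nabs_add_le[of "x - x'" 1 x'] rel_integral x by force
  then show "nabs x \<le> 1" .
  have "nabs x < 1 \<longleftrightarrow> nabs x' < 1"
    using nabs_diff_less[of x 1 "x - x'"] nabs_add_less[of "x - x'" 1 x'] x(3) by auto
  then show "s = \<zero> \<longleftrightarrow> nabs x < 1" using rel_zero_iff x by simp
  assume "(y, t) \<in> saturate A S"
  then obtain y' where y: "y \<in> A" "(y', t) \<in> S" "nabs (y - y') < 1" by (auto simp: saturate_def)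
  have "nabs ((x - y) - (x' - y')) < 1"
    using nabs_diff_less[OF x(3) y(3)] by (simp add: algebra_simps)
  then show "(x - y, s \<ominus> t) \<in> saturate A S"
    using rel_diff[OF x(2) y(2)] subring_set_diff[OF A x(1) y(1)] by (auto simp: saturate_def)
  have small: "nabs (a * b) < 1" if "nabs a \<le> 1" "nabs b < 1" for a b
    using mult_right_mono[OF that(1), of "nabs b"] that(2) by (simp add: nabs_mult)
  \<comment> \<open>The difference of the products is split so that each summand has one factor
    below 1 and one at most 1 in absolute value.\<close>
  have "nabs (x * (y - y') + y' * (x - x')) < 1"
    using small[OF le y(3)] small[OF rel_integral[OF y(2)] x(3)] by (rule nabs_add_less)
  then have "nabs (x * y - x' * y') < 1" by (simp add: algebra_simps)
  then show "(x * y, s \<otimes> t) \<in> saturate A S"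
    using rel_mult[OF x(2) y(2)] subring_set_mult[OF A x(1) y(1)] by (auto simp: saturate_def)
next
  show "(1, \<one>) \<in> saturate A S" using rel_one subring_set_1[OF A] by (auto simp: saturate_def intro!: exI[of _ 1])
qed

lemma (in residue_relation) subset_saturate: "Domain S \<subseteq> A \<Longrightarrow> S \<subseteq> saturate A S"
  by (force simp: saturate_def)

subsection \<open>Adjoining a lift of an algebraic residue\<close>

text \<open>Torsion is what algebraicity of \<open>k\<close> over a finite field amounts to.\<close>

locale residue_extension = residue_relation v k S
  for v :: "'a::field \<Rightarrow> real" and k :: "('k, 'm) ring_scheme" (structure) and S +
  fixes b :: 'k
  assumes b_carrier: "b \<in> carrier k"
    and torsion: "s \<in> carrier k \<Longrightarrow> s \<noteq> \<zero> \<Longrightarrow> \<exists>N>0. s [^] (N::nat) = \<one>"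
begin

text \<open>Pairs of a polynomial and the value at \<open>b\<close> of its reduction.\<close>

inductive_set poly_rel :: "('a poly \<times> 'k) set" where
  poly_rel_0: "(0, \<zero>) \<in> poly_rel"
| poly_rel_pCons: "(c, s) \<in> S \<Longrightarrow> (G, t) \<in> poly_rel \<Longrightarrow> (pCons c G, s \<oplus> t \<otimes> b) \<in> poly_rel"

lemma poly_rel_carrier: "(G, t) \<in> poly_rel \<Longrightarrow> t \<in> carrier k"
  by (induction rule: poly_rel.induct) (auto simp: b_carrier rel_carrier)

lemma poly_rel_over: "(G, t) \<in> poly_rel \<Longrightarrow> G \<in> poly_over (Domain S)"
  by (induction rule: poly_rel.induct)
     (auto simp: poly_over_pCons_iff intro!: poly_over_0 DomainI[OF rel_zero])

lemma poly_rel_ex: "G \<in> poly_over (Domain S) \<Longrightarrow> \<exists>t. (G, t) \<in> poly_rel"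
proof (induction G)
  case 0
  then show ?case using poly_rel_0 by blast
next
  case (pCons c G)
  then show ?case using poly_rel_pCons by (fastforce simp: poly_over_pCons_iff)
qed

lemma poly_rel_uminus: "(G, t) \<in> poly_rel \<Longrightarrow> (- G, \<ominus> t) \<in> poly_rel"
proof (induction rule: poly_rel.induct)
  case poly_rel_0
  then show ?case using poly_rel.poly_rel_0 by simp
next
  case (poly_rel_pCons c s G t)
  then show ?case
    using poly_rel.poly_rel_pCons[OF rel_uminus[OF poly_rel_pCons(1)] poly_rel_pCons(3)]
      rel_carrier[of c s] poly_rel_carrier[of G t]
    by (simp add: b_carrier k.minus_add k.l_minus)
qed

lemma poly_rel_add: "(G, t) \<in> poly_rel \<Longrightarrow> (H, u) \<in> poly_rel \<Longrightarrow> (G + H, t \<oplus> u) \<in> poly_rel"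
proof (induction arbitrary: H u rule: poly_rel.induct)
  case poly_rel_0
  then show ?case by (simp add: poly_rel_carrier)
next
  case (poly_rel_pCons c s G t)
  note GT = poly_rel_pCons
  have c: "s \<in> carrier k" "t \<in> carrier k" using GT rel_carrier poly_rel_carrier by auto
  from GT(4) show ?case
  proof (cases rule: poly_rel.cases)
    case poly_rel_0
    then show ?thesis using poly_rel.poly_rel_pCons[OF GT(1,2)] c by (simp add: b_carrier)
  next
    case (poly_rel_pCons d s' H' t')
    have c': "s' \<in> carrier k" "t' \<in> carrier k"
      using poly_rel_pCons rel_carrier poly_rel_carrier by auto
    have "(s \<oplus> t \<otimes> b) \<oplus> (s' \<oplus> t' \<otimes> b) = (s \<oplus> s') \<oplus> (t \<oplus> t') \<otimes> b"
      using c c' b_carrier by (simp add: k.l_distr k.a_ac)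
    then show ?thesis
      using poly_rel.poly_rel_pCons[OF rel_add[OF GT(1) poly_rel_pCons(3)] GT(3)[OF poly_rel_pCons(4)]]
        poly_rel_pCons(1,2) by simp
  qed
qed

lemma poly_rel_diff: "(G, t) \<in> poly_rel \<Longrightarrow> (H, u) \<in> poly_rel \<Longrightarrow> (G - H, t \<ominus> u) \<in> poly_rel"
  using poly_rel_add[OF _ poly_rel_uminus] by (simp add: k.minus_eq)

lemma poly_rel_const: "(c, s) \<in> S \<Longrightarrow> ([:c:], s) \<in> poly_rel"
  using poly_rel_pCons[OF _ poly_rel_0] rel_carrier b_carrier by fastforce

lemma poly_rel_1: "(1, \<one>) \<in> poly_rel"
  using poly_rel_const[OF rel_one] by (simp add: one_pCons)

lemma poly_rel_X: "([:0, 1:], b) \<in> poly_rel"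
  using poly_rel_pCons[OF rel_zero poly_rel_1] b_carrier by (simp add: one_pCons)

lemma poly_rel_smult: "(G, t) \<in> poly_rel \<Longrightarrow> (c, s) \<in> S \<Longrightarrow> (smult c G, s \<otimes> t) \<in> poly_rel"
proof (induction rule: poly_rel.induct)
  case poly_rel_0
  then show ?case using poly_rel.poly_rel_0 by (simp add: rel_carrier)
next
  case (poly_rel_pCons d s' G t)
  have "s \<in> carrier k" "s' \<in> carrier k" "t \<in> carrier k"
    using poly_rel_pCons rel_carrier poly_rel_carrier by auto
  then have "s \<otimes> (s' \<oplus> t \<otimes> b) = s \<otimes> s' \<oplus> (s \<otimes> t) \<otimes> b"
    using b_carrier by (simp add: k.r_distr k.m_ac)
  then show ?case
    using poly_rel.poly_rel_pCons[OF rel_mult[OF poly_rel_pCons(4,1)] poly_rel_pCons(3)[OF poly_rel_pCons(4)]]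
    by simp
qed

lemma poly_rel_mult: "(G, t) \<in> poly_rel \<Longrightarrow> (H, u) \<in> poly_rel \<Longrightarrow> (G * H, t \<otimes> u) \<in> poly_rel"
proof (induction rule: poly_rel.induct)
  case poly_rel_0
  then show ?case using poly_rel.poly_rel_0 by (simp add: poly_rel_carrier)
next
  case (poly_rel_pCons c s G t)
  have c: "s \<in> carrier k" "t \<in> carrier k" "u \<in> carrier k"
    using poly_rel_pCons rel_carrier poly_rel_carrier by auto
  have "(pCons 0 (G * H), \<zero> \<oplus> (t \<otimes> u) \<otimes> b) \<in> poly_rel"
    using poly_rel_pCons by (intro poly_rel.poly_rel_pCons rel_zero) auto
  from poly_rel_add[OF poly_rel_smult[OF poly_rel_pCons(4,1)] this]
  have "(pCons c G * H, s \<otimes> u \<oplus> (\<zero> \<oplus> (t \<otimes> u) \<otimes> b)) \<in> poly_rel" by simp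
  also have "s \<otimes> u \<oplus> (\<zero> \<oplus> (t \<otimes> u) \<otimes> b) = (s \<oplus> t \<otimes> b) \<otimes> u"
    using c b_carrier by (simp add: k.l_distr k.r_distr k.m_ac)
  finally show ?case .
qed

lemma poly_rel_power: "(G, t) \<in> poly_rel \<Longrightarrow> (G ^ n, t [^] n) \<in> poly_rel"
proof (induction n)
  case (Suc n)
  then show ?case using poly_rel_mult[of "G ^ n" "t [^] n" G t] by (simp add: mult.commute)
qed (simp add: poly_rel_1)

lemma poly_rel_small: "(G, t) \<in> poly_rel \<Longrightarrow> (\<And>i. nabs (coeff G i) < 1) \<Longrightarrow> t = \<zero>"
proof (induction rule: poly_rel.induct)
  case (poly_rel_pCons c s G t)
  have "nabs (coeff (pCons c G) 0) < 1" "nabs (coeff (pCons c G) (Suc i)) < 1" for i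
    using poly_rel_pCons.prems by blast+
  then have "nabs c < 1" and t: "t = \<zero>" using poly_rel_pCons.IH by simp_all
  then have "s = \<zero>" using rel_zero_iff poly_rel_pCons.hyps(1) by simp
  then show ?case using b_carrier t by simp
qed simp

lemma poly_rel_smallI: "G \<in> poly_over (Domain S) \<Longrightarrow> (\<And>i. nabs (coeff G i) < 1) \<Longrightarrow> (G, \<zero>) \<in> poly_rel"
  using poly_rel_ex poly_rel_small by metis

lemma Domain_integral: "x \<in> Domain S \<Longrightarrow> nabs x \<le> 1"
  using rel_integral by blast

lemma poly_rel_coeff: "(G, t) \<in> poly_rel \<Longrightarrow> coeff G i \<in> Domain S"
  using poly_rel_over by (fastforce simp: poly_over_def)

text \<open>\<open>F\<close> lifts the minimal polynomial of \<open>b\<close> over the residues in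
  \<open>Range S\<close>. Candidates exist because \<open>b\<close> is a zero of \<open>X\<close> or
  of \<open>X ^ N - 1\<close>. The last property expresses minimality: below the degree of
  \<open>F\<close>, only polynomials that reduce to zero have a reduction vanishing at
  \<open>b\<close>.\<close>

lemma ex_minimal_poly_rel:
  obtains F where "(F, \<zero>) \<in> poly_rel" "lead_coeff F = 1" "degree F > 0"
    and "\<And>R i. (R, \<zero>) \<in> poly_rel \<Longrightarrow> degree R < degree F \<Longrightarrow> nabs (coeff R i) < 1"
proof -
  define P where "P F \<longleftrightarrow> (F, \<zero>) \<in> poly_rel \<and> lead_coeff F = 1" for F
  have "\<exists>F. P F"
  proof (cases "b = \<zero>")
    case True
    then show ?thesis using poly_rel_X by (intro exI[of _ "[:0, 1:]"]) (simp add: P_def)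
  next
    case False
    then obtain N :: nat where N: "N > 0" "b [^] N = \<one>" using torsion b_carrier by blast
    have "(monom 1 N - 1, b [^] N \<ominus> \<one>) \<in> poly_rel"
      using poly_rel_diff[OF poly_rel_power[OF poly_rel_X] poly_rel_1, of N] by (simp add: monom_altdef)
    moreover have "degree (monom 1 N - 1 :: 'a poly) = N"
    proof -
      have "degree (monom 1 N + - 1 :: 'a poly) = degree (monom 1 N :: 'a poly)"
        using N(1) by (intro degree_add_eq_left) (simp add: degree_monom_eq)
      then show ?thesis by (simp add: degree_monom_eq)
    qed
    ultimately show ?thesis using N by (intro exI[of _ "monom 1 N - 1"]) (simp add: P_def k.minus_eq k.r_neg coeff_1)
  qed
  then obtain F where F: "P F" and least: "\<And>G. P G \<Longrightarrow> degree F \<le> degree G"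
    using ex_has_least_nat[of P _ degree] by blast
  show ?thesis
  proof
    show "(F, \<zero>) \<in> poly_rel" "lead_coeff F = 1" using F by (auto simp: P_def)
    show "degree F > 0"
    proof (rule ccontr)
      assume "\<not> degree F > 0"
      then obtain c where c: "F = [:c:]" by (auto elim: degree_eq_zeroE)
      then have "F = 1" using F by (simp add: P_def one_pCons)
      then have "(0, \<zero> \<ominus> \<one>) \<in> poly_rel" using F poly_rel_diff[OF _ poly_rel_1, of 1 \<zero>] by (simp add: P_def)
      then have "\<zero> \<ominus> \<one> = \<zero>" by (rule poly_rel_small) simp
      then show False by (simp add: k.minus_eq)
    qed
    fix R i assume R: "(R, \<zero>) \<in> poly_rel" "degree R < degree F"
    show "nabs (coeff R i) < 1"
    proof (rule ccontr)
      \<comment> \<open>The largest index of a unit coefficient is the degree of the reduction of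
        \<open>R\<close>. Making \<open>R\<close> monic of that degree will contradict the choice of
        \<open>F\<close>.\<close>
      define I where "I = {i. \<not> nabs (coeff R i) < 1}"
      assume "\<not> nabs (coeff R i) < 1"
      then have "i \<in> I" by (simp add: I_def)
      have I: "I \<subseteq> {..degree R}"
      proof
        fix j assume "j \<in> I"
        then have "coeff R j \<noteq> 0" by (auto simp: I_def)
        then show "j \<in> {..degree R}" by (simp add: le_degree)
      qed
      then have "finite I" using finite_subset by blast
      define n where "n = Max I"
      have n: "n \<in> I" using \<open>i \<in> I\<close> \<open>finite I\<close> unfolding n_def by (intro Max_in) auto
      have max: "j \<le> n" if "\<not> nabs (coeff R j) < 1" for j
        using that \<open>finite I\<close> by (auto simp: n_def I_def)
      define R0 where "R0 = poly_cutoff (Suc n) R"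
      have cR0: "coeff R0 j = (if j \<le> n then coeff R j else 0)" for j
        by (simp add: R0_def coeff_poly_cutoff less_Suc_eq_le)
      have "(R - R0, \<zero>) \<in> poly_rel"
      proof (rule poly_rel_smallI)
        show "R - R0 \<in> poly_over (Domain S)"
          using poly_rel_coeff[OF R(1)] subring_set_0[OF subring_set_Domain] by (auto simp: poly_over_def cR0)
        show "nabs (coeff (R - R0) j) < 1" for j
          using max[of j] by (cases "j \<le> n") (auto simp: cR0)
      qed
      from poly_rel_diff[OF R(1) this] have R0: "(R0, \<zero>) \<in> poly_rel" by (simp add: k.minus_eq)
      define c where "c = coeff R n"
      obtain s where s: "(c, s) \<in> S" using poly_rel_coeff[OF R(1), of n] by (auto simp: c_def)
      have c1: "\<not> nabs c < 1" using n by (simp add: c_def I_def)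
      then have "s \<noteq> \<zero>" using rel_zero_iff[OF s] by simp
      then obtain N :: nat where N: "N > 0" "s [^] N = \<one>" using torsion rel_carrier[OF s] by blast
      \<comment> \<open>As \<open>s [^] (N - 1)\<close> is inverse to \<open>s\<close>, the top
        coefficient becomes \<open>c ^ N\<close>, which is only congruent to 1; subtracting a small
        monomial makes it exactly 1.\<close>
      define R1 where "R1 = smult (c ^ (N - 1)) R0"
      have "(R1, \<zero>) \<in> poly_rel"
        using poly_rel_smult[OF R0 rel_power[OF s, of "N - 1"]] rel_carrier[OF s] by (simp add: R1_def)
      moreover have "(c ^ N - 1, \<zero>) \<in> S"
        using rel_diff[OF rel_power[OF s, of N] rel_one] N by (simp add: k.minus_eq k.r_neg)
      then have "nabs (c ^ N - 1) < 1" "c ^ N - 1 \<in> Domain S" using rel_zero_iff by auto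
      then have "(monom (c ^ N - 1) n, \<zero>) \<in> poly_rel"
        using subring_set_0[OF subring_set_Domain]
        by (intro poly_rel_smallI poly_over_monom) (auto simp: coeff_monom)
      ultimately have R2: "(R1 - monom (c ^ N - 1) n, \<zero> \<ominus> \<zero>) \<in> poly_rel" by (rule poly_rel_diff)
      have cN: "c ^ (N - 1) * c = c ^ N" using N(1) by (simp add: power_eq_if)
      have coeff_n: "coeff (R1 - monom (c ^ N - 1) n) n = 1"
        using cN by (simp add: R1_def cR0 c_def[symmetric])
      have deg: "degree (R1 - monom (c ^ N - 1) n) = n"
      proof (rule antisym)
        show "degree (R1 - monom (c ^ N - 1) n) \<le> n"
          by (rule degree_le) (auto simp: R1_def cR0)
        show "n \<le> degree (R1 - monom (c ^ N - 1) n)"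
          using coeff_n by (intro le_degree) simp
      qed
      have "P (R1 - monom (c ^ N - 1) n)" unfolding P_def deg using R2 coeff_n by (simp add: k.minus_eq)
      from least[OF this] show False using deg R(2) n I by auto
    qed
  qed
qed

text \<open>The intended residue map sends \<open>G(x)\<close> to the reduction of \<open>G\<close>
  at \<open>b\<close>. For a root \<open>x\<close> of \<open>F\<close>,
  \<open>poly_rel_zero_iff\<close> ensures that this depends on \<open>G(x)\<close> alone.\<close>

definition extended_rel :: "'a \<Rightarrow> ('a \<times> 'k) set" where
  "extended_rel x = (\<lambda>(G, t). (poly G x, t)) ` poly_rel"

context
  fixes F x
  assumes F: "(F, \<zero>) \<in> poly_rel" "lead_coeff F = 1" "degree F > 0"
    and F_minimal: "\<And>R i. (R, \<zero>) \<in> poly_rel \<Longrightarrow> degree R < degree F \<Longrightarrow> nabs (coeff R i) < 1"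
    and root: "poly F x = 0"
begin

lemma nabs_root_le: "nabs x \<le> 1"
  by (rule nabs_integral_root[OF Domain_integral[OF poly_rel_coeff[OF F(1)]] F(2,3) root])

lemma nabs_poly_rel_le: "(G, t) \<in> poly_rel \<Longrightarrow> nabs (poly G x) \<le> 1"
  by (intro nabs_poly_le nabs_root_le Domain_integral poly_rel_coeff)

text \<open>Division by \<open>F\<close> does not change the value at \<open>x\<close>. The
  reduction of the remainder still vanishes at \<open>b\<close>, so minimality makes its
  coefficients small.\<close>

lemma nabs_poly_rel_small:
  assumes "(G, \<zero>) \<in> poly_rel" shows "nabs (poly G x) < 1"
proof -
  obtain Q R where QR: "Q \<in> poly_over (Domain S)" "G = Q * F + R" "degree R < degree F"
    using poly_over_monic_division[OF subring_set_Domain poly_rel_over[OF F(1)] F(2,3) poly_rel_over[OF assms]] by blast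
  obtain q where q: "(Q, q) \<in> poly_rel" using poly_rel_ex QR by blast
  have "(G - Q * F, \<zero> \<ominus> q \<otimes> \<zero>) \<in> poly_rel" by (intro poly_rel_diff poly_rel_mult assms q F)
  then have "(R, \<zero>) \<in> poly_rel" using QR poly_rel_carrier[OF q] by (simp add: k.minus_eq)
  then have "nabs (poly R x) < 1" using F_minimal QR by (intro nabs_poly_less nabs_root_le) auto
  then show ?thesis using QR root by simp
qed

text \<open>For the converse, torsion turns a nonzero residue into 1: then \<open>G ^ N - 1\<close>
  has residue 0, which forces \<open>nabs (poly G x) ^ N = 1\<close>.\<close>

lemma poly_rel_zero_iff:
  assumes "(G, t) \<in> poly_rel" shows "t = \<zero> \<longleftrightarrow> nabs (poly G x) < 1"
proof
  show "nabs (poly G x) < 1" if "t = \<zero>" using nabs_poly_rel_small assms that by simp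
  show "t = \<zero>" if less: "nabs (poly G x) < 1"
  proof (rule ccontr)
    assume "t \<noteq> \<zero>"
    then obtain N :: nat where N: "N > 0" "t [^] N = \<one>" using torsion poly_rel_carrier[OF assms] by blast
    have "(G ^ N - 1, \<zero>) \<in> poly_rel"
      using poly_rel_diff[OF poly_rel_power[OF assms, of N] poly_rel_1] N by (simp add: k.minus_eq k.r_neg)
    from nabs_poly_rel_small[OF this] have "nabs (poly G x ^ N - 1) < 1" by (simp add: poly_power)
    then have "nabs (poly G x) ^ N = 1" using nabs_eqI[of "poly G x ^ N" 1] by (simp add: nabs_power)
    moreover have "nabs (poly G x) ^ N < 1" using less N(1) by (simp add: power_less_one_iff)
    ultimately show False by simp
  qed
qed

lemma residue_relation_extended_rel: "residue_relation v k (extended_rel x)"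
proof
  fix y z s t assume "(y, s) \<in> extended_rel x"
  then obtain G where G: "(G, s) \<in> poly_rel" "y = poly G x" by (auto simp: extended_rel_def)
  show "s \<in> carrier k" using poly_rel_carrier G by simp
  show "nabs y \<le> 1" using nabs_poly_rel_le G by simp
  show "s = \<zero> \<longleftrightarrow> nabs y < 1" using poly_rel_zero_iff G by simp
  assume "(z, t) \<in> extended_rel x"
  then obtain H where H: "(H, t) \<in> poly_rel" "z = poly H x" by (auto simp: extended_rel_def)
  show "(y - z, s \<ominus> t) \<in> extended_rel x"
    unfolding extended_rel_def using poly_rel_diff[OF G(1) H(1)] G H by (intro image_eqI) auto
  show "(y * z, s \<otimes> t) \<in> extended_rel x"
    unfolding extended_rel_def using poly_rel_mult[OF G(1) H(1)] G H by (intro image_eqI) auto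
next
  show "(1, \<one>) \<in> extended_rel x"
    unfolding extended_rel_def using poly_rel_1 by (intro image_eqI) auto
qed

text \<open>On remainders the absolute value at \<open>x\<close> is the Gauss norm, the largest
  absolute value of a coefficient. Hence no new values arise, and an integral element comes from a
  remainder with integral coefficients, which has a residue.\<close>

lemma adjoin_residue:
  assumes L: "subring_set L" "Domain S \<subseteq> L" "\<And>y. y \<in> L \<Longrightarrow> nabs y \<le> 1 \<Longrightarrow> y \<in> Domain S"
    and L_inv: "\<And>y. y \<in> L \<Longrightarrow> y \<noteq> 0 \<Longrightarrow> \<exists>z\<in>L. nabs (y * z) = 1"
    and z: "z \<in> adjoin L x" "z \<noteq> 0"
  shows "\<exists>c\<in>L. c \<noteq> 0 \<and> nabs z = nabs c" and "nabs z \<le> 1 \<Longrightarrow> z \<in> Domain (extended_rel x)"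
proof -
  have "F \<in> poly_over L" using poly_over_mono[OF L(2)] poly_rel_over[OF F(1)] .
  then obtain R where R: "R \<in> poly_over L" "degree R < degree F" "z = poly R x"
    using adjoin_reduce[OF L(1) _ F(2,3) root z(1)] by blast
  define m where "m = Max ((\<lambda>i. nabs (coeff R i)) ` {..degree R})"
  have "m \<in> (\<lambda>i. nabs (coeff R i)) ` {..degree R}" unfolding m_def by (intro Max_in) auto
  then obtain i where i: "m = nabs (coeff R i)" by auto
  have le_m: "nabs (coeff R j) \<le> nabs (coeff R i)" for j
  proof (cases "j \<le> degree R")
    case True
    then show ?thesis unfolding i[symmetric] m_def by (intro Max_ge) auto
  qed (simp add: coeff_eq_0)
  define c where "c = coeff R i"
  have c: "c \<in> L" "c \<noteq> 0"
  proof -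
    show "c \<in> L" using R(1) by (simp add: c_def poly_over_def)
    show "c \<noteq> 0"
    proof
      assume "c = 0"
      then have "coeff R j = 0" for j using le_m[of j] by (metis c_def nabs_0 nabs_eq_0_iff nabs_nonneg order_antisym)
      then have "R = 0" by (intro poly_eqI) simp
      then show False using R(3) z(2) by simp
    qed
  qed
  \<comment> \<open>Scaling by \<open>y\<close> gives the largest coefficient absolute value 1. The
    scaled remainder has integral coefficients and a nonzero reduction, so minimality of
    \<open>F\<close> makes its residue nonzero.\<close>
  obtain y where y: "y \<in> L" "nabs (c * y) = 1" using L_inv c by blast
  have "nabs (coeff (smult y R) j) \<le> 1" for j
    using mult_right_mono[OF le_m[of j], of "nabs y"] y(2) by (simp add: nabs_mult c_def mult.commute)
  then have "smult y R \<in> poly_over (Domain S)"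
    using poly_over_smult[OF L(1) y(1) R(1)] L(3) by (simp add: poly_over_def)
  then obtain t where t: "(smult y R, t) \<in> poly_rel" using poly_rel_ex by blast
  have "t \<noteq> \<zero>"
  proof
    assume "t = \<zero>"
    then have "nabs (coeff (smult y R) i) < 1"
      using F_minimal[of "smult y R" i] t R(2) degree_smult_le[of y R] by (metis le_less_trans)
    then show False using y(2) by (simp add: c_def mult.commute)
  qed
  then have "nabs (y * z) = 1"
    using poly_rel_zero_iff[OF t] nabs_poly_rel_le[OF t] R(3) by simp
  then have "nabs y * nabs z = nabs y * nabs c" "nabs y \<noteq> 0"
    using y(2) by (auto simp: nabs_mult mult.commute)
  then have zc: "nabs z = nabs c" by (simp del: nabs_eq_0_iff)
  then show "\<exists>c\<in>L. c \<noteq> 0 \<and> nabs z = nabs c" using c by blast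
  assume "nabs z \<le> 1"
  then have "coeff R j \<in> Domain S" for j
    using le_m[of j] zc R(1) by (intro L(3)) (auto simp: c_def poly_over_def)
  then obtain u where "(R, u) \<in> poly_rel" using poly_rel_ex[of R] by (auto simp: poly_over_def)
  then show "z \<in> Domain (extended_rel x)" using R(3) by (force simp: extended_rel_def)
qed

end

lemma subset_extended_rel: "S \<subseteq> extended_rel x"
proof
  fix p assume "p \<in> S"
  then have "([:fst p:], snd p) \<in> poly_rel" by (simp add: poly_rel_const)
  then show "p \<in> extended_rel x" unfolding extended_rel_def by (intro image_eqI) auto
qed

lemma extended_rel_root: "(x, b) \<in> extended_rel x"
  unfolding extended_rel_def using poly_rel_X by (intro image_eqI) auto

lemma Domain_extended_rel_subset:
  assumes "Domain S \<subseteq> L" shows "Domain (extended_rel x) \<subseteq> adjoin L x"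
  using poly_over_mono[OF assms poly_rel_over] by (auto simp: extended_rel_def adjoin_def)

end

subsection \<open>Algebraic numbers and the prime field\<close>

definition algebraic_elts :: "'c::field_char_0 set" where
  "algebraic_elts = {x. algebraic x}"

context
  fixes R :: "'c::field ring"
  defines "R \<equiv> ring_of_type_algebra"
begin

interpretation R: field R
  unfolding R_def by (rule field_from_type_algebra)

lemma type_ring_simps:
  "carrier R = UNIV" "x \<otimes>\<^bsub>R\<^esub> y = x * y" "x \<oplus>\<^bsub>R\<^esub> y = x + y" "\<one>\<^bsub>R\<^esub> = 1" "\<zero>\<^bsub>R\<^esub> = 0"
  by (simp_all add: R_def ring_of_type_algebra_def)

lemma type_ring_uminus: "\<ominus>\<^bsub>R\<^esub> x = - x"
proof -
  have "\<ominus>\<^bsub>R\<^esub> x + x = 0" using R.l_neg[of x] by (simp add: type_ring_simps)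
  then show ?thesis by (simp add: eq_neg_iff_add_eq_0)
qed

lemma type_ring_pow: "x [^]\<^bsub>R\<^esub> (n::nat) = x ^ n"
  by (induction n) (simp_all add: type_ring_simps mult.commute)

text \<open>Lists for \<open>eval\<close> start with the leading coefficient, those for
  \<open>Poly\<close> with the constant one, hence \<open>rev\<close>.\<close>

lemma type_ring_eval: "R.eval xs x = poly (Poly (rev xs)) x"
  by (induction xs) (simp_all add: type_ring_simps type_ring_pow Poly_append poly_monom)

lemma subring_setI_subring: "subring K R \<Longrightarrow> subring_set K"
  unfolding subring_set_def
  using subringE(3,5,6,7)[of K R] by (simp add: type_ring_simps type_ring_uminus) (metis diff_conv_add_uminus)

lemma rev_coeffs_carrier:
  assumes "subring K R" "P \<noteq> 0" "P \<in> poly_over K"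
  shows "rev (coeffs P) \<in> carrier (K[X]\<^bsub>R\<^esub>)" "rev (coeffs P) \<noteq> []"
proof -
  have "set (coeffs P) \<subseteq> K" using assms(3) by (auto simp: poly_over_def coeffs_def)
  then show "rev (coeffs P) \<in> carrier (K[X]\<^bsub>R\<^esub>)"
    using assms(2) unfolding univ_poly_carrier[symmetric] polynomial_def
    by (simp add: hd_rev last_coeffs_eq_coeff_degree type_ring_simps)
  show "rev (coeffs P) \<noteq> []" using assms(2) by simp
qed

end

context
  fixes R :: "'c::field_char_0 ring"
  defines "R \<equiv> ring_of_type_algebra"
begin

interpretation R: field R
  unfolding R_def by (rule field_from_type_algebra)

lemmas R_simps = type_ring_simps[where 'c = 'c, folded R_def]
lemmas R_uminus = type_ring_uminus[where 'c = 'c, folded R_def]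
lemmas R_eval = type_ring_eval[where 'c = 'c, folded R_def]
lemmas R_subring_set = subring_setI_subring[where 'c = 'c, folded R_def]
lemmas R_rev_coeffs = rev_coeffs_carrier[where 'c = 'c, folded R_def]

lemma subfield_Rats: "subfield \<rat> R"
proof (rule R.subfieldI'[OF R.subringI])
  fix x assume "x \<in> \<rat> - {\<zero>\<^bsub>R\<^esub>}"
  then have "x \<in> \<rat>" "x \<noteq> 0" by (auto simp: R_simps)
  then have "inv\<^bsub>R\<^esub> x = inverse x" by (intro R.comm_inv_char) (auto simp: R_simps)
  then show "inv\<^bsub>R\<^esub> x \<in> \<rat>" using \<open>x \<in> \<rat>\<close> by simp
qed (auto simp: R_simps R_uminus)

lemma algebraic_iff: "algebraic x \<longleftrightarrow> (R.algebraic over \<rat>) x"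
proof
  assume "algebraic x"
  then obtain P where "P \<in> poly_over \<rat>" "P \<noteq> 0" "poly P x = 0"
    unfolding algebraic_altdef poly_over_def by blast
  then show "(R.algebraic over \<rat>) x"
    using R_rev_coeffs[OF subfieldE(1)[OF subfield_Rats]]
    by (intro R.algebraicI[of "rev (coeffs P)"]) (auto simp: R_eval R_simps)
next
  assume "(R.algebraic over \<rat>) x"
  then obtain p where p: "p \<in> carrier (\<rat>[X]\<^bsub>R\<^esub>)" "p \<noteq> []" "R.eval p x = 0"
    using R.algebraicE[OF subfieldE(1)[OF subfield_Rats], of x] by (auto simp: R_simps)
  then have set_p: "set p \<subseteq> \<rat>" and "hd p \<noteq> 0"
    unfolding univ_poly_carrier[symmetric] polynomial_def by (auto simp: R_simps)
  have "coeff (Poly (rev p)) (length p - 1) \<noteq> 0"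
    using p(2) \<open>hd p \<noteq> 0\<close> by (simp add: coeff_Poly_eq nth_default_def rev_nth hd_conv_nth)
  then have "Poly (rev p) \<noteq> 0" by (metis coeff_0)
  moreover have "coeff (Poly (rev p)) i \<in> \<rat>" for i
    using set_p by (auto simp: coeff_Poly_eq nth_default_def intro!: subsetD[OF set_p] simp: rev_nth)
  ultimately show "algebraic x" using p(3) by (intro algebraicI') (auto simp: R_eval)
qed

lemma subring_set_algebraic: "subring_set (algebraic_elts :: 'c set)"
proof (rule R_subring_set)
  have "(algebraic_elts :: 'c set) = {x \<in> carrier R. (R.algebraic over \<rat>) x}"
    by (auto simp: algebraic_elts_def algebraic_iff R_simps)
  then show "subring (algebraic_elts :: 'c set) R"
    using subfieldE(1)[OF R.subfield_of_algebraics[OF subfield_Rats]] by simp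
qed

text \<open>The coefficients generate a finite extension \<open>E\<close> of \<rat>, and
  \<open>x\<close> generates a finite extension of \<open>E\<close>; finiteness is
  transitive.\<close>

lemma algebraic_root_algebraic:
  assumes F: "F \<noteq> 0" "F \<in> poly_over (algebraic_elts :: 'c set)" and root: "poly F x = 0"
  shows "algebraic x"
proof -
  define E where "E = R.finite_extension \<rat> (coeffs F)"
  have carr: "set (coeffs F) \<subseteq> carrier R" by (simp add: R_simps)
  have alg: "(R.algebraic over \<rat>) y" if "y \<in> set (coeffs F)" for y
    using F that by (auto simp: poly_over_def coeffs_def algebraic_iff[symmetric] algebraic_elts_def)
  have E: "subfield E R" "R.finite_dimension \<rat> E"
    unfolding E_def
    using R.finite_extension_is_subfield[OF subfield_Rats carr alg]
      R.finite_extension_finite_dimension(1)[OF subfield_Rats carr alg] by blast+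
  have "set (coeffs F) \<subseteq> E"
    unfolding E_def by (rule R.finite_extension_mem[OF subfieldE(1)[OF subfield_Rats] carr])
  moreover have "0 \<in> E" using subring_set_0[OF R_subring_set[OF subfieldE(1)[OF E(1)]]] .
  ultimately have "range (coeff F) \<subseteq> E" by (simp add: range_coeff)
  then have "F \<in> poly_over E" by (auto simp: poly_over_def)
  then have "(R.algebraic over E) x"
    using R_rev_coeffs[OF subfieldE(1)[OF E(1)] F(1)] root
    by (intro R.algebraicI[of "rev (coeffs F)"]) (auto simp: R_eval R_simps)
  then have "R.finite_dimension E (R.simple_extension E x)"
    using R.finite_dimension_simple_extension[OF E(1), of x] by (simp add: R_simps)
  then have "R.finite_dimension \<rat> (R.simple_extension E x)"
    using R.telescopic_base_dim(1)[OF subfield_Rats E] by blast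
  moreover have "subring (R.simple_extension E x) R"
    using R.simple_extension_is_subring[OF subfieldE(1)[OF E(1)]] by (simp add: R_simps)
  moreover have "x \<in> R.simple_extension E x"
    using R.simple_extension_mem[OF subfieldE(1)[OF E(1)]] by (simp add: R_simps)
  ultimately show ?thesis
    using R.finite_dimension_imp_algebraic[OF subfield_Rats] by (simp add: algebraic_iff)
qed

text \<open>Translates the abstract closure into polynomials of the type; splitting over the carrier
  becomes the existence of a root in \<open>Q\<close>.\<close>

lemma algebraic_closure_type:
  assumes "algebraic_closure (R\<lparr>carrier := Q\<rparr>) K"
  shows "subring_set Q" and "K \<subseteq> Q"
    and "P \<in> poly_over Q \<Longrightarrow> degree P > 0 \<Longrightarrow> \<exists>x\<in>Q. poly P x = 0"
proof -
  interpret Q: algebraic_closure "R\<lparr>carrier := Q\<rparr>" K by fact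
  have "subfield Q R"
    using R.subfield_iff(1)[of Q] Q.field_axioms by (simp add: R_simps)
  then have Q: "subring Q R" by (rule subfieldE(1))
  then show "subring_set Q" by (rule R_subring_set)
  show "K \<subseteq> Q" using subfieldE(3)[OF Q.subfield_axioms] by simp
  assume P: "P \<in> poly_over Q" "degree P > 0"
  define p where "p = rev (coeffs P)"
  have p: "p \<in> carrier (Q[X]\<^bsub>R\<^esub>)"
    using R_rev_coeffs(1)[OF Q _ P(1)] P(2) by (cases "P = 0") (auto simp: p_def)
  also have "Q[X]\<^bsub>R\<^esub> = univ_poly (R\<lparr>carrier := Q\<rparr>) Q"
    by (simp add: R.univ_poly_consistent[OF Q])
  finally have p': "p \<in> carrier (poly_ring (R\<lparr>carrier := Q\<rparr>))" by simp
  then have "Q.splitted p" by (rule Q.roots_over_carrier)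
  moreover have "Polynomials.degree p = degree P"
    by (simp add: p_def degree_eq_length_coeffs)
  ultimately have "Q.roots p \<noteq> {#}" using P(2) unfolding Q.splitted_def by auto
  then obtain x where "x \<in># Q.roots p" by blast
  then have "Q.is_root p x" using Q.roots_mem_iff_is_root[OF p'] by simp
  then have "x \<in> Q" "Q.eval p x = 0" by (auto simp: Q.is_root_def R_simps)
  moreover have "Q.eval p x = poly P x"
    using R.eval_consistent[OF Q] by (simp add: R_eval p_def)
  ultimately show "\<exists>x\<in>Q. poly P x = 0" by auto
qed

end

section \<open>Torsion and the prime field\<close>

lemma (in ring) nat_pow_in_subring:
  assumes "subring H R" "x \<in> H" shows "x [^] (n::nat) \<in> H"
  using assms(2) by (induction n) (auto intro: subringE(3,6)[OF assms(1)])

text \<open>\<open>F[x]\<close> is a finite-dimensional space over a finite field, hence finite. Two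
  powers of \<open>x\<close> coincide, and the common factor cancels.\<close>

lemma (in field) algebraic_over_finite_torsion:
  assumes F: "subfield F R" "finite F" and x: "x \<in> carrier R" "(algebraic over F) x" "x \<noteq> \<zero>"
  shows "\<exists>N>0. x [^] (N::nat) = \<one>"
proof -
  define E where "E = simple_extension F x"
  have E: "subring E R" "x \<in> E"
    using simple_extension_is_subring[OF subfieldE(1)[OF F(1)]] simple_extension_mem[OF subfieldE(1)[OF F(1)]] x
    by (auto simp: E_def)
  obtain n where "dimension n F E"
    using finite_dimension_simple_extension[OF F(1) x(1)] x(2) by (auto simp: E_def)
  then obtain Us where Us: "set Us \<subseteq> carrier R" "Span F Us = E" using exists_base[OF F(1)] by blast
  have "E = (\<lambda>Ks. combine Ks Us) ` {Ks. set Ks \<subseteq> F \<and> length Ks = length Us}"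
    using Span_eq_combine_set_length_version[OF F(1) Us(1)] Us(2) by auto
  then have "finite E" using finite_lists_length_eq[OF F(2)] by simp
  moreover have "range (\<lambda>n::nat. x [^] n) \<subseteq> E" using nat_pow_in_subring[OF E] by blast
  ultimately have "\<not> inj (\<lambda>n::nat. x [^] n)" using finite_subset infinite_UNIV_nat finite_imageD by metis
  then obtain i j :: nat where "x [^] i = x [^] j" "i \<noteq> j" by (auto simp: inj_def)
  then obtain i d :: nat where d: "d > 0" "x [^] (i + d) = x [^] i"
    by (metis less_imp_add_positive linorder_neqE_nat)
  have xi: "x [^] i \<in> carrier R" "x [^] d \<in> carrier R" using x(1) by auto
  have nz: "x [^] i \<noteq> \<zero>" using x(1,3) by (induction i) (simp_all add: integral_iff)
  have "x [^] i \<otimes> x [^] d = x [^] i \<otimes> \<one>" using d(2) x(1) xi by (simp add: nat_pow_mult)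
  then have "x [^] d = \<one>" using m_lcancel[OF nz xi one_closed] by simp
  then show ?thesis using d(1) by blast
qed

text \<open>\<open>g\<close> is the projection of the integers modulo \<open>p\<close>, followed by
  an isomorphism onto \<open>F\<close>. A Bezout relation excludes a larger kernel, since
  \<open>g\<close> maps 1 to one.\<close>

lemma prime_field_hom:
  assumes "prime p" "field k" "subfield F k" "k\<lparr>carrier := F\<rparr> \<simeq> ZFact (int p)"
  obtains g :: "int \<Rightarrow> 'k" where "g \<in> ring_hom \<Z> k" "\<And>n. g n = \<zero>\<^bsub>k\<^esub> \<longleftrightarrow> int p dvd n" "finite F"
proof -
  interpret k: field k by fact
  interpret F: field "k\<lparr>carrier := F\<rparr>" using k.subfield_iff(2)[OF assms(3)] .
  define I where "I = Idl\<^bsub>\<Z>\<^esub> {int p}"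
  have I: "ideal I \<Z>" unfolding I_def by (rule int.genideal_ideal) simp
  interpret I: ideal I \<Z> by (rule I)
  have ZFact: "ZFact (int p) = \<Z> Quot I" by (simp add: ZFact_def I_def)
  have pI: "int p \<in> I" unfolding I_def using int.genideal_self' by simp
  obtain f where f: "f \<in> ring_iso (\<Z> Quot I) (k\<lparr>carrier := F\<rparr>)"
    using ring_iso_sym[OF F.ring_axioms assms(4)] unfolding is_ring_iso_def ZFact by blast
  define g where "g = f \<circ> (\<lambda>n. I +>\<^bsub>\<Z>\<^esub> n)"
  have gF: "g \<in> ring_hom \<Z> (k\<lparr>carrier := F\<rparr>)"
    unfolding g_def using f by (intro ring_hom_trans[OF I.rcos_ring_hom]) (simp add: ring_iso_def)
  have "F \<subseteq> carrier k" using subfieldE(3)[OF assms(3)] .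
  then have g: "g \<in> ring_hom \<Z> k"
    using ring_hom_memE[OF gF] by (intro ring_hom_memI) auto
  interpret g: ring_hom_ring \<Z> k g
    by (intro ring_hom_ringI2 int.ring_axioms k.ring_axioms g)
  have gp: "g (int p) = \<zero>\<^bsub>k\<^esub>"
  proof -
    interpret Q: ring "\<Z> Quot I" by (rule I.quotient_is_ring)
    have "I +>\<^bsub>\<Z>\<^esub> int p = \<zero>\<^bsub>\<Z> Quot I\<^esub>"
      using I.a_rcos_const[OF pI] by (simp add: FactRing_def)
    moreover have "f \<zero>\<^bsub>\<Z> Quot I\<^esub> = \<zero>\<^bsub>k\<^esub>"
      using ring_hom_zero[OF _ Q.ring_axioms F.ring_axioms, of f] f by (simp add: ring_iso_def)
    ultimately show ?thesis by (simp add: g_def)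
  qed
  have mult: "g (int p * n) = \<zero>\<^bsub>k\<^esub>" for n
    using g.hom_mult[of "int p" n] gp by simp
  have iff: "g n = \<zero>\<^bsub>k\<^esub> \<longleftrightarrow> int p dvd n" for n
  proof
    show "g n = \<zero>\<^bsub>k\<^esub>" if "int p dvd n" using that mult by (auto simp: dvd_def)
    show "int p dvd n" if "g n = \<zero>\<^bsub>k\<^esub>"
    proof (rule ccontr)
      assume "\<not> int p dvd n"
      then have "coprime (int p) n" using assms(1) by (simp add: prime_imp_coprime)
      then obtain a b where ab: "a * int p + b * n = 1"
        using bezout_int[of "int p" n] by (auto simp: coprime_iff_gcd_eq_1)
      have "g (a * int p + b * n) = \<zero>\<^bsub>k\<^esub>"
        using g.hom_add[of "a * int p" "b * n"] g.hom_mult[of b n] that mult[of a] by (simp add: mult.commute)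
      then show False using ab g.hom_one by simp
    qed
  qed
  have "F \<subseteq> g ` {0..<int p}"
  proof
    fix s assume "s \<in> F"
    then obtain Y where "Y \<in> carrier (\<Z> Quot I)" "s = f Y"
      using f by (fastforce simp: ring_iso_def bij_betw_def)
    then obtain n where n: "s = g n" by (auto simp: g_def FactRing_def A_RCOSETS_def')
    have "g n = g (int p * (n div int p) + n mod int p)" by simp
    also have "\<dots> = g (n mod int p)"
      using g.hom_add[of "int p * (n div int p)" "n mod int p"] mult by simp
    finally show "s \<in> g ` {0..<int p}" using n prime_gt_0_nat[OF assms(1)] by simp
  qed
  then have "finite F" using finite_subset by blast
  then show ?thesis using that g iff by blast
qed

subsection \<open>Extensions with prescribed residues and values\<close>

context valued_field
begin

lemma nabs_eq_iff: "x \<noteq> 0 \<Longrightarrow> y \<noteq> 0 \<Longrightarrow> nabs x = nabs y \<longleftrightarrow> v x = v y"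
  by (simp add: nabs_eq)

lemma val_1 [simp]: "v 1 = 0"
  using val_mult[of 1 1] by simp

lemma val_power: "x \<noteq> 0 \<Longrightarrow> v (x ^ n) = n * v x"
  by (induction n) (auto simp: val_mult algebra_simps)

lemma val_inverse: "x \<noteq> 0 \<Longrightarrow> v (inverse x) = - v x"
  using val_mult[of x "inverse x"] by simp

lemma val_divide: "x \<noteq> 0 \<Longrightarrow> y \<noteq> 0 \<Longrightarrow> v (x / y) = v x - v y"
  by (simp add: divide_inverse val_mult val_inverse)

lemma nabs_inverse: "nabs (inverse x) = inverse (nabs x)"
  by (cases "x = 0") (auto simp: nabs_eq val_inverse exp_minus)

lemma nabs_divide: "nabs (x / y) = nabs x / nabs y"
  by (simp add: divide_inverse nabs_mult nabs_inverse)

lemma nabs_eq_1_iff: "x \<noteq> 0 \<Longrightarrow> nabs x = 1 \<longleftrightarrow> v x = 0"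
  by (simp add: nabs_eq)

lemma nabs_le_1_iff: "x \<noteq> 0 \<Longrightarrow> nabs x \<le> 1 \<longleftrightarrow> 0 \<le> v x"
  by (simp add: nabs_eq)

end

section \<open>Rational and algebraic numbers in the p-adic field\<close>

context padic_complex_field
begin

lemma val_of_int: "n \<noteq> 0 \<Longrightarrow> v (of_int n) = multiplicity (int p) n"
  using val_of_rat[of "of_int n"] by (simp add: padic_val_rat_def)

lemma val_p: "v (of_nat p) = 1"
  using val_of_int[of "int p"] prime_p by (auto simp: prime_gt_0_nat multiplicity_self)

lemma nabs_of_int_le: "nabs (of_int n) \<le> 1"
  by (cases "n = 0") (simp_all add: nabs_eq val_of_int)

lemma nabs_of_int_less_iff: "nabs (of_int n) < 1 \<longleftrightarrow> int p dvd n"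
proof (cases "n = 0")
  case False
  then show ?thesis
    using prime_p by (simp add: nabs_eq val_of_int prime_multiplicity_gt_zero_iff)
qed simp

lemma ex_Rats_val: "\<exists>a\<in>\<rat>. a \<noteq> 0 \<and> v a = of_int n"
proof -
  have p0: "(of_nat p :: 'c) \<noteq> 0" using prime_p by auto
  show ?thesis
  proof (cases "n \<ge> 0")
    case True
    then show ?thesis using p0
      by (intro bexI[of _ "of_nat p ^ nat n"]) (auto simp: val_power val_p)
  next
    case False
    then show ?thesis using p0
      by (intro bexI[of _ "inverse (of_nat p ^ nat (- n))"]) (auto simp: val_power val_inverse val_p)
  qed
qed

text \<open>An integral fraction \<open>a / b\<close> in lowest terms has denominator prime to
  \<open>p\<close>. With \<open>d\<close> inverse to \<open>b\<close> modulo \<open>p\<close>, it is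
  congruent to \<open>a * d\<close>.\<close>

lemma Rats_integral_near_int:
  assumes "x \<in> \<rat>" "nabs x \<le> 1"
  shows "\<exists>m. nabs (x - of_int m) < 1"
proof (cases "x = 0")
  case False
  obtain q where q: "x = of_rat q" using assms(1) by (auto elim: Rats_cases)
  obtain a b where ab: "quotient_of q = (a, b)" by force
  then have b: "b > 0" "coprime a b" and qab: "q = of_int a / of_int b"
    using quotient_of_denom_pos quotient_of_coprime quotient_of_div by auto
  have x: "x = of_int a / of_int b" by (simp add: q qab of_rat_divide)
  have "a \<noteq> 0" using False x by auto
  have pp: "prime (int p)" using prime_p by simp
  have "\<not> int p dvd b"
  proof
    assume pb: "int p dvd b"
    then have "\<not> int p dvd a" using b(2) pp by (meson coprime_common_divisor not_prime_unit)
    then have "\<not> nabs (of_int a) < 1" using nabs_of_int_less_iff by simp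
    moreover have "nabs (of_int b) < 1" using pb nabs_of_int_less_iff by simp
    moreover have "nabs (of_int a) \<le> nabs (of_int b)"
    proof -
      have "nabs x * nabs (of_int b) = nabs (of_int a)"
        using x b(1) by (simp add: nabs_mult[symmetric])
      then show ?thesis using mult_right_mono[OF assms(2), of "nabs (of_int b)"] by simp
    qed
    ultimately show False by linarith
  qed
  then have cop: "coprime (int p) b" using pp by (simp add: prime_imp_coprime)
  then obtain c d where cd: "c * int p + d * b = 1"
    using bezout_int[of "int p" b] by (auto simp: coprime_iff_gcd_eq_1)
  have b1: "nabs (of_int b) = 1"
    using nabs_of_int_less_iff[of b] \<open>\<not> int p dvd b\<close> nabs_of_int_le[of b] by simp
  have "of_int c * of_nat p + of_int d * of_int b = (1 :: 'c)"
    using arg_cong[OF cd, of "of_int :: int \<Rightarrow> 'c"] by simp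
  then have eq: "1 - of_int d * of_int b = (of_int (c * int p) :: 'c)" by (simp add: algebra_simps)
  have "x - of_int (a * d) = of_int a * (1 - of_int d * of_int b) / of_int b"
    using x b(1) by (simp add: field_simps)
  also have "nabs \<dots> = nabs (of_int (a * (c * int p)))"
    by (simp only: eq nabs_divide b1) simp
  also have "\<dots> < 1" unfolding nabs_of_int_less_iff by simp
  finally show ?thesis by blast
qed (auto intro: exI[of _ 0])

text \<open>\<open>Qpbar\<close> supplies roots, and algebraicity over \<rat> supplies countability.
  All rings of the construction lie in this intersection.\<close>

definition algebraic_closure_Q :: "'c set" where
  "algebraic_closure_Q = Qpbar \<inter> algebraic_elts"

lemma Qpbar_facts:
  shows "subring_set Qpbar" "\<rat> \<subseteq> Qpbar"
    "P \<in> poly_over Qpbar \<Longrightarrow> degree P > 0 \<Longrightarrow> \<exists>x\<in>Qpbar. poly P x = 0"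
  using algebraic_closure_type[OF closure_Qpbar] completion_Qp by (auto simp: is_completion_def)

lemma subring_set_algebraic_closure_Q: "subring_set algebraic_closure_Q"
  using Qpbar_facts(1) subring_set_algebraic unfolding algebraic_closure_Q_def subring_set_def by auto

lemma Rats_subset_algebraic_closure_Q: "\<rat> \<subseteq> algebraic_closure_Q"
  using Qpbar_facts(2) by (auto simp: algebraic_closure_Q_def algebraic_elts_def rat_imp_algebraic)

lemma algebraic_closure_Q_root:
  assumes "P \<in> poly_over algebraic_closure_Q" "degree P > 0"
  shows "\<exists>x\<in>algebraic_closure_Q. poly P x = 0"
proof -
  have P: "P \<in> poly_over Qpbar" "P \<in> poly_over algebraic_elts"
    using assms(1) by (auto simp: algebraic_closure_Q_def poly_over_def)
  obtain x where "x \<in> Qpbar" "poly P x = 0" using Qpbar_facts(3)[OF P(1) assms(2)] by blast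
  moreover have "algebraic x" using algebraic_root_algebraic[OF _ P(2), of x] assms(2) calculation by (cases "P = 0") auto
  ultimately show ?thesis by (auto simp: algebraic_closure_Q_def algebraic_elts_def)
qed

end

section \<open>Pairs of a ring and a residue map\<close>

locale prescribed_extension = padic_complex_field p v Qp Qpbar + k: field k
  for p and v :: "'c::field_char_0 \<Rightarrow> real" and Qp Qpbar and k :: "('k, 'm) ring_scheme" (structure) +
  fixes \<Gamma> :: "rat set" and g :: "int \<Rightarrow> 'k"
  assumes group_diff: "a \<in> \<Gamma> \<Longrightarrow> b \<in> \<Gamma> \<Longrightarrow> a - b \<in> \<Gamma>"
    and Ints_group: "\<int> \<subseteq> \<Gamma>"
    and g_hom: "g \<in> ring_hom \<Z> k"
    and g_zero_iff: "g n = \<zero> \<longleftrightarrow> int p dvd n"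
    and torsion: "s \<in> carrier k \<Longrightarrow> s \<noteq> \<zero> \<Longrightarrow> \<exists>N>0. s [^] (N::nat) = \<one>"
begin

definition real_group :: "real set" where
  "real_group = of_rat ` \<Gamma>"

lemma real_group_diff: "a \<in> real_group \<Longrightarrow> b \<in> real_group \<Longrightarrow> a - b \<in> real_group"
  unfolding real_group_def by (auto simp: of_rat_diff[symmetric] intro: group_diff)

lemma real_group_of_int: "of_int n \<in> real_group"
  unfolding real_group_def using Ints_group by (intro image_eqI[of _ _ "of_int n"]) auto

lemma real_group_add: "a \<in> real_group \<Longrightarrow> b \<in> real_group \<Longrightarrow> a + b \<in> real_group"
  using real_group_diff[of a "0 - b"] real_group_diff[of 0 b] real_group_of_int[of 0] by simp

lemma real_group_mult_nat: "a \<in> real_group \<Longrightarrow> real n * a \<in> real_group"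
  using real_group_of_int[of 0] by (induction n) (auto simp: algebra_simps real_group_add)

text \<open>\<open>Domain S\<close> is the whole valuation ring of \<open>L\<close>, so
  \<open>S\<close> induces an embedding of the residue field of \<open>L\<close> into
  \<open>k\<close>. The partners \<open>y\<close> make the values of \<open>L\<close> a
  group.\<close>

definition tower :: "'c set \<Rightarrow> ('c \<times> 'k) set \<Rightarrow> bool" where
  "tower L S \<longleftrightarrow> \<rat> \<subseteq> L \<and> subring_set L \<and> L \<subseteq> algebraic_closure_Q \<and>
     (\<forall>x\<in>L. x \<noteq> 0 \<longrightarrow> v x \<in> real_group \<and> (\<exists>y\<in>L. nabs (x * y) = 1)) \<and>
     residue_relation v k S \<and> Domain S = {x \<in> L. nabs x \<le> 1}"

text \<open>\<open>g\<close> gives residues of integers. Integral rationals are congruent to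
  integers, so saturation extends these residues to all of them.\<close>

lemma tower_base: "\<exists>S. tower \<rat> S"
proof -
  define S where "S = range (\<lambda>n. (of_int n :: 'c, g n))"
  interpret g: ring_hom_ring \<Z> k g
    by (intro ring_hom_ringI2 int.ring_axioms k.ring_axioms g_hom)
  interpret S: residue_relation v k S
  proof
    fix x y s t assume "(x, s) \<in> S"
    then obtain m where m: "x = of_int m" "s = g m" by (auto simp: S_def)
    show "s \<in> carrier k" using m by simp
    show "nabs x \<le> 1" using m nabs_of_int_le by simp
    show "s = \<zero> \<longleftrightarrow> nabs x < 1" using m nabs_of_int_less_iff g_zero_iff by simp
    assume "(y, t) \<in> S"
    then obtain n where n: "y = of_int n" "t = g n" by (auto simp: S_def)
    have "g (m - n) = g m \<ominus> g n"
      using g.hom_add[of m "- n"] g.hom_a_inv[of n] by (simp add: k.minus_eq int_a_inv_eq)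
    then show "(x - y, s \<ominus> t) \<in> S"
      unfolding S_def using m n by (intro range_eqI[of _ _ "m - n"]) simp
    show "(x * y, s \<otimes> t) \<in> S"
      unfolding S_def using m n g.hom_mult[of m n] by (intro range_eqI[of _ _ "m * n"]) simp
  next
    show "(1, \<one>) \<in> S"
      unfolding S_def using g.hom_one by (intro range_eqI[of _ _ 1]) simp
  qed
  have Q: "subring_set (\<rat> :: 'c set)" by (auto simp: subring_set_def)
  interpret T: residue_relation v k "saturate \<rat> S" by (rule S.residue_relation_saturate[OF Q])
  have "v x \<in> real_group" if x: "x \<in> \<rat>" "x \<noteq> 0" for x
  proof -
    obtain q where "x = of_rat q" using x(1) by (auto elim: Rats_cases)
    then show ?thesis using val_of_rat[of q] x(2) real_group_of_int by simp
  qed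
  moreover have "\<exists>y\<in>\<rat>. nabs (x * y) = 1" if "x \<in> \<rat>" "x \<noteq> 0" for x
    using that by (intro bexI[of _ "inverse x"]) auto
  moreover have "Domain (saturate \<rat> S) = {x \<in> \<rat>. nabs x \<le> 1}"
  proof
    show "Domain (saturate \<rat> S) \<subseteq> {x \<in> \<rat>. nabs x \<le> 1}"
      using T.rel_integral by (auto simp: saturate_def)
    show "{x \<in> \<rat>. nabs x \<le> 1} \<subseteq> Domain (saturate \<rat> S)"
    proof
      fix x assume "x \<in> {x \<in> \<rat>. nabs x \<le> 1}"
      then obtain m where "x \<in> \<rat>" "nabs (x - of_int m) < 1" using Rats_integral_near_int by blast
      then have "(x, g m) \<in> saturate \<rat> S" unfolding saturate_def S_def by blast
      then show "x \<in> Domain (saturate \<rat> S)" by blast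
    qed
  qed
  ultimately show ?thesis
    using Q T.residue_relation_axioms Rats_subset_algebraic_closure_Q by (auto simp: tower_def)
qed

text \<open>The adjoined root receives the residue \<open>b\<close>, so the graph grows properly; by
  \<open>adjoin_residue\<close> each nonzero new element has the value of an element of
  \<open>L\<close>.\<close>

lemma tower_residue_step:
  assumes tower: "tower L S" and b: "b \<in> carrier k" "b \<notin> Range S"
  shows "\<exists>L' S'. tower L' S' \<and> L \<subseteq> L' \<and> S \<subseteq> S' \<and> S' \<noteq> S"
proof -
  have L: "\<rat> \<subseteq> L" "subring_set L" "L \<subseteq> algebraic_closure_Q" and S: "residue_relation v k S"
    and Lv: "\<And>x. x \<in> L \<Longrightarrow> x \<noteq> 0 \<Longrightarrow> v x \<in> real_group"
    and Linv: "\<And>x. x \<in> L \<Longrightarrow> x \<noteq> 0 \<Longrightarrow> \<exists>y\<in>L. nabs (x * y) = 1"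
    and dom: "Domain S = {x \<in> L. nabs x \<le> 1}"
    using tower by (auto simp: tower_def)
  interpret residue_relation v k S by (rule S)
  interpret residue_extension v k S b
    by unfold_locales (use b torsion in auto)
  obtain F where F: "(F, \<zero>) \<in> poly_rel" "lead_coeff F = 1" "degree F > 0"
    "\<And>R i. (R, \<zero>) \<in> poly_rel \<Longrightarrow> degree R < degree F \<Longrightarrow> nabs (coeff R i) < 1"
    using ex_minimal_poly_rel by blast
  have domL: "Domain S \<subseteq> L" using dom by auto
  have "F \<in> poly_over algebraic_closure_Q"
    using poly_over_mono[OF _ poly_rel_over[OF F(1)]] domL L(3) by blast
  then obtain x where x: "x \<in> algebraic_closure_Q" "poly F x = 0"
    using algebraic_closure_Q_root F(3) by blast
  interpret E: residue_relation v k "extended_rel x"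
    using residue_relation_extended_rel[OF F x(2)] .
  have domI: "\<And>y. y \<in> L \<Longrightarrow> nabs y \<le> 1 \<Longrightarrow> y \<in> Domain S" using dom by auto
  have adj: "\<exists>c\<in>L. c \<noteq> 0 \<and> nabs z = nabs c" "nabs z \<le> 1 \<Longrightarrow> z \<in> Domain (extended_rel x)"
    if "z \<in> adjoin L x" "z \<noteq> 0" for z
    using that by (auto intro!: adjoin_residue[OF F x(2) L(2) domL domI Linv])
  have "v z \<in> real_group \<and> (\<exists>y\<in>adjoin L x. nabs (z * y) = 1)" if z: "z \<in> adjoin L x" "z \<noteq> 0" for z
  proof -
    obtain c where c: "c \<in> L" "c \<noteq> 0" "nabs z = nabs c" using adj(1)[OF z] by blast
    obtain y where y: "y \<in> L" "nabs (c * y) = 1" using Linv[OF c(1,2)] by blast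
    then have "nabs (z * y) = 1" using c(3) by (simp add: nabs_mult)
    moreover have "v z = v c" using c(2,3) z(2) nabs_eq_iff by blast
    ultimately show ?thesis using Lv[OF c(1,2)] subset_adjoin[OF L(2), of x] y(1) by auto
  qed
  moreover have "Domain (extended_rel x) = {z \<in> adjoin L x. nabs z \<le> 1}"
  proof
    show "Domain (extended_rel x) \<subseteq> {z \<in> adjoin L x. nabs z \<le> 1}"
      using Domain_extended_rel_subset[OF domL] E.rel_integral by blast
    show "{z \<in> adjoin L x. nabs z \<le> 1} \<subseteq> Domain (extended_rel x)"
      using adj(2) E.rel_zero by (auto intro: DomainI)
  qed
  moreover have "\<rat> \<subseteq> adjoin L x" using L(1) subset_adjoin[OF L(2)] by blast
  ultimately have "tower (adjoin L x) (extended_rel x)"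
    unfolding tower_def
    using subring_set_adjoin[OF L(2)] adjoin_minimal[OF subring_set_algebraic_closure_Q L(3) x(1)]
      E.residue_relation_axioms by blast
  then show ?thesis
    using subset_adjoin[OF L(2), of x] subset_extended_rel extended_rel_root[of x] b(2) by blast
qed

text \<open>A root of \<open>X ^ m - a\<close> has value \<gamma>, and by the choice of
  \<open>m\<close> its powers below \<open>m\<close> have values in distinct classes modulo those of
  \<open>L\<close>. The nonzero terms of a remainder therefore differ in absolute value, and only
  the constant one can be a unit, so no new residue arises.\<close>

lemma tower_value_step:
  assumes tower: "tower L S" and \<gamma>: "\<gamma> \<in> real_group" "\<not> (\<exists>x\<in>L. x \<noteq> 0 \<and> v x = \<gamma>)"
  shows "\<exists>L' S'. tower L' S' \<and> L \<subseteq> L' \<and> S \<subseteq> S' \<and> L' \<noteq> L"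
proof -
  have L: "\<rat> \<subseteq> L" "subring_set L" "L \<subseteq> algebraic_closure_Q" and S: "residue_relation v k S"
    and Lv: "\<And>x. x \<in> L \<Longrightarrow> x \<noteq> 0 \<Longrightarrow> v x \<in> real_group"
    and Linv: "\<And>x. x \<in> L \<Longrightarrow> x \<noteq> 0 \<Longrightarrow> \<exists>y\<in>L. nabs (x * y) = 1"
    and dom: "Domain S = {x \<in> L. nabs x \<le> 1}"
    using tower by (auto simp: tower_def)
  interpret residue_relation v k S by (rule S)
  have Lneg: "\<exists>y\<in>L. y \<noteq> 0 \<and> v y = - v x" if x: "x \<in> L" "x \<noteq> 0" for x
  proof -
    obtain y where y: "y \<in> L" "nabs (x * y) = 1" using Linv[OF x] by blast
    then have "y \<noteq> 0" by auto
    then have "v x + v y = 0" using y(2) x(2) nabs_eq_1_iff[of "x * y"] by (simp add: val_mult)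
    then show ?thesis using y \<open>y \<noteq> 0\<close> by force
  qed
  define P where "P j \<longleftrightarrow> j > 0 \<and> (\<exists>a\<in>L. a \<noteq> 0 \<and> v a = real j * \<gamma>)" for j
  define m where "m = (LEAST j. P j)"
  \<comment> \<open>The denominator of \<gamma> is such a \<open>j\<close>: it makes the multiple an
    integer, and every integer is the value of a power of \<open>p\<close>.\<close>
  have "\<exists>j. P j"
  proof -
    obtain q where q: "\<gamma> = of_rat q" using \<gamma>(1) by (auto simp: real_group_def)
    obtain n d where nd: "quotient_of q = (n, d)" by force
    then have "d > 0" "q = of_int n / of_int d"
      using quotient_of_denom_pos quotient_of_div by auto
    then have "real (nat d) * \<gamma> = of_int n" by (simp add: q of_rat_divide)
    moreover obtain a :: 'c where "a \<in> \<rat>" "a \<noteq> 0" "v a = of_int n" using ex_Rats_val by blast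
    ultimately have "P (nat d)" using L(1) \<open>d > 0\<close> by (auto simp: P_def)
    then show ?thesis ..
  qed
  then have "P m" unfolding m_def by (rule LeastI_ex)
  then obtain a where m: "m > 0" and a: "a \<in> L" "a \<noteq> 0" "v a = real m * \<gamma>" by (auto simp: P_def)
  have minimal: "v c \<noteq> real j * \<gamma>" if "c \<in> L" "c \<noteq> 0" "0 < j" "j < m" for c j
  proof -
    have "\<not> P j" using not_less_Least[of j P] that(4) by (simp add: m_def)
    then show ?thesis using that by (auto simp: P_def)
  qed
  define F where "F = monom 1 m + [:- a:]"
  have deg_F: "degree F = m"
    unfolding F_def using m by (subst degree_add_eq_left) (auto simp: degree_monom_eq)
  have F: "F \<in> poly_over L" "lead_coeff F = 1"
  proof -
    show "F \<in> poly_over L" unfolding F_def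
      using a(1) by (intro poly_over_add L(2) poly_over_monom)
        (auto simp: poly_over_pCons_iff poly_over_0 subring_set_0[OF L(2)] subring_set_1[OF L(2)] subring_set_uminus[OF L(2)])
    show "lead_coeff F = 1" unfolding deg_F using m by (simp add: F_def coeff_pCons split: nat.split)
  qed
  obtain x where x: "x \<in> algebraic_closure_Q" "poly F x = 0"
    using algebraic_closure_Q_root[of F] poly_over_mono[OF L(3) F(1)] deg_F m by auto
  have xm: "x ^ m = a" using x(2) by (simp add: F_def poly_monom)
  then have x0: "x \<noteq> 0" using a(2) m by auto
  have "real m * v x = real m * \<gamma>" by (simp only: val_power[OF x0, of m, symmetric] xm a(3))
  then have vx: "v x = \<gamma>" using m by simp
  define L' where "L' = adjoin L x"
  have L': "subring_set L'" "L \<subseteq> L'" "x \<in> L'"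
    unfolding L'_def using subring_set_adjoin subset_adjoin in_adjoin L(2) by blast+
  have main: "v z \<in> real_group \<and> (\<exists>y\<in>L'. nabs (z * y) = 1) \<and>
      (nabs z \<le> 1 \<longrightarrow> (\<exists>c\<in>Domain S. nabs (z - c) < 1))" if z: "z \<in> L'" "z \<noteq> 0" for z
  proof -
    obtain R where R: "R \<in> poly_over L" "degree R < m" "z = poly R x"
      using adjoin_reduce[OF L(2) F _ x(2)] z(1) m unfolding deg_F L'_def by blast
    define f where "f j = coeff R j * x ^ j" for j
    have cL: "coeff R j \<in> L" for j using R(1) by (simp add: poly_over_def)
    have zf: "z = sum f {..<m}"
      unfolding R(3) poly_altdef f_def
      using R(2) by (intro sum.mono_neutral_left) (auto simp: coeff_eq_0)
    have vf: "v (f j) = v (coeff R j) + real j * \<gamma>" if "f j \<noteq> 0" for j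
      using that by (simp add: f_def val_mult val_power x0 vx)
    have distinct: "nabs (f i) \<noteq> nabs (f j)" if "i < j" "j < m" "f i \<noteq> 0" "f j \<noteq> 0" for i j
    proof
      assume "nabs (f i) = nabs (f j)"
      then have eq: "v (coeff R i) - v (coeff R j) = real (j - i) * \<gamma>"
        using that nabs_eq_iff vf by (simp add: of_nat_diff algebra_simps)
      have nz: "coeff R i \<noteq> 0" "coeff R j \<noteq> 0" using that by (auto simp: f_def)
      \<comment> \<open>Multiplication by \<open>y\<close> puts \<open>(j - i) * \<gamma>\<close>
        among the values of \<open>L\<close>, against minimality of \<open>m\<close>.\<close>
      obtain y where y: "y \<in> L" "y \<noteq> 0" "v y = - v (coeff R j)" using Lneg[OF cL nz(2)] by blast
      then have "v (coeff R i * y) = real (j - i) * \<gamma>" using eq nz by (simp add: val_mult)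
      moreover have "0 < j - i" "j - i < m" using that by linarith+
      ultimately show False
        using minimal[OF subring_set_mult[OF L(2) cL y(1)], of i "j - i"] nz y(2) by simp
    qed
    have "\<exists>i\<in>{..<m}. f i \<noteq> 0 \<and> nabs (sum f {..<m}) = nabs (f i) \<and> (\<forall>j\<in>{..<m}. nabs (f j) \<le> nabs (f i))"
    proof (rule nabs_sum_distinct)
      show "\<exists>i\<in>{..<m}. f i \<noteq> 0" using z(2) zf sum.neutral[of "{..<m}" f] by blast
      show "nabs (f i) \<noteq> nabs (f j)" if "i \<in> {..<m}" "j \<in> {..<m}" "i \<noteq> j" "f i \<noteq> 0" "f j \<noteq> 0" for i j
        using distinct[of i j] distinct[of j i] that by (cases i j rule: linorder_cases) auto
    qed simp
    then obtain i where i: "i < m" "f i \<noteq> 0" "nabs z = nabs (f i)" "\<And>j. j < m \<Longrightarrow> nabs (f j) \<le> nabs z"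
      unfolding zf[symmetric] by force
    have ci: "coeff R i \<noteq> 0" using i(2) by (auto simp: f_def)
    have "v z = v (coeff R i) + real i * \<gamma>" using i z(2) nabs_eq_iff vf by simp
    then have "v z \<in> real_group" using real_group_add[OF Lv[OF cL ci] real_group_mult_nat[OF \<gamma>(1)]] by simp
    moreover have "\<exists>y\<in>L'. nabs (z * y) = 1"
    proof -
      obtain c' where c': "c' \<in> L" "nabs (coeff R i * c') = 1" using Linv[OF cL ci] by blast
      obtain a' where a': "a' \<in> L" "nabs (a * a') = 1" using Linv a by blast
      \<comment> \<open>The factor \<open>x ^ (m - i)\<close> completes the dominant term to a
        multiple of \<open>x ^ m = a\<close>, so partners of its coefficient and of \<open>a\<close>
        yield one for \<open>z\<close>.\<close>
      have "c' * (a' * x ^ (m - i)) \<in> L'"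
        using L' c' a' by (intro subring_set_mult[OF L'(1)] subring_set_power[OF L'(1)]) auto
      moreover have "f i * (c' * (a' * x ^ (m - i))) = (coeff R i * c') * (a * a')"
        using i(1) by (simp add: f_def xm[symmetric] power_add[symmetric])
      then have "nabs (z * (c' * (a' * x ^ (m - i)))) = 1"
        using i(3) c' a' by (metis nabs_mult mult_1)
      ultimately show ?thesis by blast
    qed
    \<comment> \<open>The constant term serves as \<open>c\<close>: a later term of absolute value 1
      would make \<open>j * \<gamma>\<close> a value of \<open>L\<close> with
      \<open>0 < j < m\<close>.\<close>
    moreover have "\<exists>c\<in>Domain S. nabs (z - c) < 1" if le: "nabs z \<le> 1"
    proof (intro bexI)
      have "nabs (f 0) \<le> 1" using i(4)[OF m] le by simp
      then show "f 0 \<in> Domain S" using cL by (simp add: dom f_def)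
      have "z = f 0 + sum f {0<..<m}"
        unfolding zf using m by (metis atLeast0LessThan atLeastSucLessThan_greaterThanLessThan sum.atLeast_Suc_lessThan)
      moreover have "nabs (sum f {0<..<m}) < 1"
      proof (rule nabs_sum_less)
        fix j assume j: "j \<in> {0<..<m}"
        have "nabs (f j) \<noteq> 1"
        proof
          assume "nabs (f j) = 1"
          then have "f j \<noteq> 0" by auto
          then have nz: "f j \<noteq> 0" "coeff R j \<noteq> 0" by (auto simp: f_def)
          then have vj: "v (coeff R j) + real j * \<gamma> = 0" using vf nabs_eq_1_iff \<open>nabs (f j) = 1\<close> by simp
          moreover obtain y where "y \<in> L" "y \<noteq> 0" "v y = - v (coeff R j)" using Lneg[OF cL nz(2)] by blast
          ultimately show False using minimal[of y j] j by simp
        qed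
        then show "nabs (f j) < 1" using i(4)[of j] j le by simp
      qed simp
      ultimately show "nabs (z - f 0) < 1" by simp
    qed
    ultimately show ?thesis by blast
  qed
  interpret T: residue_relation v k "saturate L' S" by (rule residue_relation_saturate[OF L'(1)])
  have "Domain (saturate L' S) = {z \<in> L'. nabs z \<le> 1}"
  proof
    show "Domain (saturate L' S) \<subseteq> {z \<in> L'. nabs z \<le> 1}"
      using T.rel_integral by (auto simp: saturate_def)
    show "{z \<in> L'. nabs z \<le> 1} \<subseteq> Domain (saturate L' S)"
    proof
      fix z assume z: "z \<in> {z \<in> L'. nabs z \<le> 1}"
      show "z \<in> Domain (saturate L' S)"
      proof (cases "z = 0")
        case True
        then show ?thesis using T.rel_zero by (auto intro: DomainI)
      next
        case False
        then show ?thesis using main[of z] z by (auto simp: saturate_def)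
      qed
    qed
  qed
  moreover have "L' \<subseteq> algebraic_closure_Q"
    unfolding L'_def by (rule adjoin_minimal[OF subring_set_algebraic_closure_Q L(3) x(1)])
  moreover have "\<rat> \<subseteq> L'" using L(1) L'(2) by blast
  ultimately have "tower L' (saturate L' S)"
    unfolding tower_def using L'(1) main T.residue_relation_axioms by blast
  moreover have "S \<subseteq> saturate L' S" using dom L'(2) by (intro subset_saturate) auto
  moreover have "L' \<noteq> L" using L'(3) \<gamma>(2) x0 vx by blast
  ultimately show ?thesis using L'(2) by blast
qed

text \<open>Closure conditions concern at most two elements at a time, and these lie in a common
  member of the chain.\<close>

lemma tower_Union:
  assumes "C \<noteq> {}" and tower: "\<And>c. c \<in> C \<Longrightarrow> tower (fst c) (snd c)"
    and chain: "\<And>c d. c \<in> C \<Longrightarrow> d \<in> C \<Longrightarrow> (fst c \<subseteq> fst d \<and> snd c \<subseteq> snd d) \<or> (fst d \<subseteq> fst c \<and> snd d \<subseteq> snd c)"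
  shows "tower (\<Union> (fst ` C)) (\<Union> (snd ` C))"
proof -
  have L2: "\<exists>c\<in>C. x \<in> fst c \<and> y \<in> fst c" if "x \<in> \<Union> (fst ` C)" "y \<in> \<Union> (fst ` C)" for x y
    using that chain by blast
  have S2: "\<exists>c\<in>C. a \<in> snd c \<and> b \<in> snd c" if "a \<in> \<Union> (snd ` C)" "b \<in> \<Union> (snd ` C)" for a b
    using that chain by blast
  have rr: "residue_relation v k (snd c)" if "c \<in> C" for c using tower[OF that] by (simp add: tower_def)
  have sub: "subring_set (fst c)" if "c \<in> C" for c using tower[OF that] by (simp add: tower_def)
  have "subring_set (\<Union> (fst ` C))"
    unfolding subring_set_def
  proof (intro conjI ballI)
    show "1 \<in> \<Union> (fst ` C)" using assms(1) subring_set_1[OF sub] by blast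
    fix x y assume "x \<in> \<Union> (fst ` C)" "y \<in> \<Union> (fst ` C)"
    then obtain c where c: "c \<in> C" "x \<in> fst c" "y \<in> fst c" using L2 by blast
    then show "x - y \<in> \<Union> (fst ` C)" "x * y \<in> \<Union> (fst ` C)"
      using subring_set_diff[OF sub[OF c(1)] c(2,3)] subring_set_mult[OF sub[OF c(1)] c(2,3)] by blast+
  qed
  moreover have "residue_relation v k (\<Union> (snd ` C))"
  proof
    fix x y s t assume xs: "(x, s) \<in> \<Union> (snd ` C)"
    then obtain c where c: "c \<in> C" "(x, s) \<in> snd c" by blast
    interpret c: residue_relation v k "snd c" by (rule rr[OF c(1)])
    show "s \<in> carrier k" "nabs x \<le> 1" "s = \<zero> \<longleftrightarrow> nabs x < 1"
      using c.rel_carrier[OF c(2)] c.rel_integral[OF c(2)] c.rel_zero_iff[OF c(2)] by auto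
    assume "(y, t) \<in> \<Union> (snd ` C)"
    from S2[OF xs this] obtain d where d: "d \<in> C" "(x, s) \<in> snd d" "(y, t) \<in> snd d" by blast
    interpret d: residue_relation v k "snd d" by (rule rr[OF d(1)])
    show "(x - y, s \<ominus> t) \<in> \<Union> (snd ` C)" "(x * y, s \<otimes> t) \<in> \<Union> (snd ` C)"
      using d.rel_diff[OF d(2,3)] d.rel_mult[OF d(2,3)] d(1) by blast+
  next
    show "(1, \<one>) \<in> \<Union> (snd ` C)" using assms(1) residue_relation.rel_one[OF rr] by blast
  qed
  moreover obtain c0 where "c0 \<in> C" using assms(1) by blast
  then have "\<rat> \<subseteq> fst c0" "fst c0 \<subseteq> \<Union> (fst ` C)" using tower by (auto simp: tower_def)
  then have "\<rat> \<subseteq> \<Union> (fst ` C)" by (rule subset_trans)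
  moreover have "fst c \<subseteq> algebraic_closure_Q" if "c \<in> C" for c using tower[OF that] by (simp add: tower_def)
  then have "\<Union> (fst ` C) \<subseteq> algebraic_closure_Q" by blast
  moreover have "\<forall>x\<in>\<Union> (fst ` C). x \<noteq> 0 \<longrightarrow> v x \<in> real_group \<and> (\<exists>y\<in>\<Union> (fst ` C). nabs (x * y) = 1)"
    using tower unfolding tower_def by blast
  moreover have "Domain (snd c) = {x \<in> fst c. nabs x \<le> 1}" if "c \<in> C" for c
    using tower[OF that] by (simp add: tower_def)
  then have "(\<Union>c\<in>C. Domain (snd c)) = (\<Union>c\<in>C. {x \<in> fst c. nabs x \<le> 1})" by simp
  then have "Domain (\<Union> (snd ` C)) = {x \<in> \<Union> (fst ` C). nabs x \<le> 1}" by blast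
  ultimately show ?thesis unfolding tower_def by (intro conjI)
qed

text \<open>The order compares ring and graph together, so growth of either contradicts maximality:
  the residue step enlarges the graph, the value step the ring.\<close>

lemma ex_full_tower:
  obtains L S where "tower L S" "Range S = carrier k" "v ` (L - {0}) = real_group"
proof -
  define le where "le c d \<longleftrightarrow> fst c \<subseteq> fst d \<and> snd c \<subseteq> snd d" for c d :: "'c set \<times> ('c \<times> 'k) set"
  define A where "A = {c. tower (fst c) (snd c)}"
  have "\<exists>m\<in>A. \<forall>a\<in>A. le m a \<longrightarrow> a = m"
  proof (rule predicate_Zorn)
    show "partial_order_on A (relation_of le A)"
      by (rule partial_order_on_relation_ofI) (auto simp: le_def prod_eq_iff)
    fix C assume "C \<in> Chains (relation_of le A)"
    then have C: "C \<subseteq> A" "\<And>c d. c \<in> C \<Longrightarrow> d \<in> C \<Longrightarrow> le c d \<or> le d c"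
      by (auto simp: Chains_def relation_of_def)
    show "\<exists>u\<in>A. \<forall>a\<in>C. le a u"
    proof (cases "C = {}")
      case True
      then show ?thesis using tower_base by (auto simp: A_def)
    next
      case False
      have "tower (\<Union> (fst ` C)) (\<Union> (snd ` C))"
        using C by (intro tower_Union[OF False]) (auto simp: A_def le_def)
      then show ?thesis by (intro bexI[of _ "(\<Union> (fst ` C), \<Union> (snd ` C))"]) (auto simp: A_def le_def)
    qed
  qed
  then obtain L S where LS: "tower L S" and
    max: "\<And>L' S'. tower L' S' \<Longrightarrow> L \<subseteq> L' \<Longrightarrow> S \<subseteq> S' \<Longrightarrow> L' = L \<and> S' = S"
    by (auto simp: A_def le_def)
  have "Range S \<subseteq> carrier k"
    using LS residue_relation.rel_carrier unfolding tower_def by fast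
  moreover have "b \<in> Range S" if "b \<in> carrier k" for b
    using tower_residue_step[OF LS that] max by metis
  then have "carrier k \<subseteq> Range S" by blast
  moreover have "v ` (L - {0}) \<subseteq> real_group" using LS by (auto simp: tower_def)
  moreover have "\<exists>x\<in>L. x \<noteq> 0 \<and> v x = \<gamma>" if "\<gamma> \<in> real_group" for \<gamma>
    using tower_value_step[OF LS that] max by metis
  then have "real_group \<subseteq> v ` (L - {0})" by blast
  ultimately show ?thesis by (intro that[OF LS] equalityI)
qed

end

subsection \<open>A generic point\<close>

definition rat_eval :: "rat poly \<Rightarrow> 'a::field_char_0 \<Rightarrow> 'a" where
  "rat_eval f x = poly (map_poly of_rat f) x"

lemma rat_eval_simps [simp]:
  "rat_eval 0 x = 0" "rat_eval 1 x = 1" "rat_eval (pCons c f) x = of_rat c + x * rat_eval f x"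
  by (simp_all add: rat_eval_def map_poly_pCons)

lemma rat_eval_add: "rat_eval (f + g) x = rat_eval f x + rat_eval g x"
proof -
  have "map_poly of_rat (f + g) = (map_poly of_rat f + map_poly of_rat g :: 'a poly)"
    by (intro poly_eqI) (simp add: coeff_map_poly of_rat_add)
  then show ?thesis by (simp add: rat_eval_def)
qed

lemma rat_eval_smult: "rat_eval (smult c f) x = of_rat c * rat_eval f x"
  by (induction f) (simp_all add: of_rat_mult algebra_simps)

lemma rat_eval_mult: "rat_eval (f * g) x = rat_eval f x * rat_eval g x"
  by (induction f) (simp_all add: rat_eval_add rat_eval_smult algebra_simps)

lemma rat_eval_in_subring:
  assumes "subring_set L" "\<rat> \<subseteq> L" "x \<in> L"
  shows "rat_eval f x \<in> L"
proof -
  have "map_poly of_rat f \<in> poly_over L" using assms(2) by (auto simp: poly_over_def coeff_map_poly)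
  then show ?thesis unfolding rat_eval_def using assms by (intro poly_over_eval)
qed

lemma pderiv_map_poly_of_rat: "pderiv (map_poly of_rat f) = (map_poly of_rat (pderiv f) :: 'a::field_char_0 poly)"
  by (intro poly_eqI) (simp add: coeff_map_poly coeff_pderiv of_rat_mult of_rat_add)

lemma algebraic_rat_eval:
  assumes "f \<noteq> 0" "rat_eval f x = 0" shows "algebraic x"
  using assms by (intro algebraicI'[of "map_poly of_rat f"])
    (auto simp: rat_eval_def coeff_map_poly poly_eq_iff map_poly_eq_0_iff)

lemma countable_algebraic: "countable {x :: 'a::field_char_0. algebraic x}"
proof -
  have "{x :: 'a. algebraic x} \<subseteq> (\<Union>f\<in>-{0::int poly}. {x. poly (map_poly of_int f) x = 0})"
    by (auto elim: algebraicE')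
  moreover have "countable (\<Union>f\<in>-{0::int poly}. {x :: 'a. poly (map_poly of_int f) x = 0})"
  proof (intro countable_UN)
    show "countable {x :: 'a. poly (map_poly of_int f) x = 0}" if "f \<in> - {0::int poly}" for f
    proof -
      have "map_poly of_int f \<noteq> (0 :: 'a poly)" using that by (subst map_poly_eq_0_iff) auto
      then show ?thesis by (intro countable_finite poly_roots_finite)
    qed
  next
    have "inj_on coeffs (- {0 :: int poly})" by (rule inj_onI) (simp only: coeffs_eq_iff)
    moreover have "countable (coeffs ` (- {0 :: int poly}))" by (rule countable_subset[OF subset_UNIV]) simp
    ultimately show "countable (- {0 :: int poly})" using countable_image_inj_on by blast
  qed
  ultimately show ?thesis by (rule countable_subset)
qed

text \<open>A polynomial of minimal degree vanishing at \<open>a\<close>; its derivative cannot vanish there.\<close>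

lemma ex_simple_root:
  assumes "algebraic a"
  shows "\<exists>f. rat_eval f a = 0 \<and> rat_eval (pderiv f) a \<noteq> 0"
proof -
  obtain f0 :: "int poly" where f0: "f0 \<noteq> 0" "poly (map_poly of_int f0) a = 0"
    using algebraicE'[OF assms] .
  define P where "P f \<longleftrightarrow> f \<noteq> 0 \<and> rat_eval f a = 0" for f
  have "map_poly of_rat (map_poly of_int f0) = (map_poly of_int f0 :: 'a poly)"
    by (intro poly_eqI) (simp add: coeff_map_poly)
  moreover have "map_poly of_int f0 \<noteq> (0 :: rat poly)" using f0(1) by (subst map_poly_eq_0_iff) auto
  ultimately have "P (map_poly of_int f0)" using f0(2) by (simp add: P_def rat_eval_def)
  then obtain f where f: "P f" and least: "\<And>h. P h \<Longrightarrow> degree f \<le> degree h"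
    using ex_has_least_nat[of P _ degree] by blast
  have "degree f > 0"
  proof (rule ccontr)
    assume "\<not> degree f > 0"
    then obtain c where "f = [:c:]" by (auto elim: degree_eq_zeroE)
    then show False using f by (simp add: P_def)
  qed
  then have "degree (pderiv f) < degree f" "pderiv f \<noteq> 0" by (auto simp: degree_pderiv pderiv_eq_0_iff)
  then have "rat_eval (pderiv f) a \<noteq> 0" using least[of "pderiv f"] by (auto simp: P_def)
  then show ?thesis using f by (auto simp: P_def)
qed

context valued_field
begin

text \<open>Horner recursion, with the difference \<open>x Q(x) - a Q(a)\<close> split as
  \<open>x (Q(x) - Q(a)) + (x - a) Q(a)\<close>.\<close>

lemma poly_continuous:
  "\<epsilon> > 0 \<Longrightarrow> \<exists>\<delta>>0. \<forall>x. nabs (x - a) \<le> \<delta> \<longrightarrow> nabs (poly P x - poly P a) < \<epsilon>"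
proof (induction P arbitrary: \<epsilon>)
  case 0
  then show ?case by (auto intro: exI[of _ 1])
next
  case (pCons c Q)
  define r where "r = nabs a + 1"
  define s where "s = nabs (poly Q a) + 1"
  have rs: "r > 0" "s > 0" by (simp_all add: r_def s_def add_nonneg_pos)
  obtain \<delta> where \<delta>: "\<delta> > 0" "\<And>x. nabs (x - a) \<le> \<delta> \<Longrightarrow> nabs (poly Q x - poly Q a) < \<epsilon> / r"
    using pCons.IH[of "\<epsilon> / r"] pCons.prems rs(1) by auto
  \<comment> \<open>The bounds control \<open>Q(x) - Q(a)\<close>, keep \<open>nabs x\<close> at
    most \<open>r\<close>, and make \<open>(x - a) Q(a)\<close> small; the factor 2 secures a strict
    inequality.\<close>
  define \<delta>' where "\<delta>' = min \<delta> (min 1 (\<epsilon> / (2 * s)))"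
  have "nabs (poly (pCons c Q) x - poly (pCons c Q) a) < \<epsilon>" if x: "nabs (x - a) \<le> \<delta>'" for x
  proof -
    have "nabs x \<le> max (nabs (x - a)) (nabs a)" using nabs_add[of "x - a" a] by simp
    moreover have "nabs (x - a) \<le> 1" using x by (simp add: \<delta>'_def)
    ultimately have "nabs x \<le> r" using nabs_nonneg[of a] unfolding r_def by linarith
    then have "nabs x * nabs (poly Q x - poly Q a) \<le> r * nabs (poly Q x - poly Q a)"
      by (intro mult_right_mono) auto
    also have "\<dots> < \<epsilon>" using \<delta>(2)[of x] x rs(1) by (simp add: \<delta>'_def field_simps)
    finally have 1: "nabs (x * (poly Q x - poly Q a)) < \<epsilon>" by (simp add: nabs_mult)
    have "nabs (x - a) * nabs (poly Q a) \<le> (\<epsilon> / (2 * s)) * s"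
      using x rs(2) pCons.prems by (intro mult_mono) (auto simp: \<delta>'_def s_def)
    also have "\<dots> < \<epsilon>" using rs(2) pCons.prems by simp
    finally have 2: "nabs ((x - a) * poly Q a) < \<epsilon>" by (simp add: nabs_mult)
    show ?thesis using nabs_add_less[OF 1 2] by (simp add: algebra_simps)
  qed
  moreover have "\<delta>' > 0" using \<delta>(1) rs pCons.prems by (simp add: \<delta>'_def)
  ultimately show ?case by blast
qed

end

context padic_complex_field
begin

text \<open>The witness \<open>g\<close> is the derivative of a polynomial \<open>f\<close> with a simple root at \<open>a\<close>.\<close>

lemma newton_quotient:
  fixes a :: 'c
  assumes "algebraic a"
  shows "\<exists>f g. \<exists>r>0. \<forall>x. x \<noteq> a \<longrightarrow> nabs (x - a) \<le> r \<longrightarrow>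
    rat_eval g x \<noteq> 0 \<and> nabs (rat_eval f x / rat_eval g x - (x - a)) < nabs (x - a)"
proof -
  obtain f where f: "rat_eval f a = 0" "rat_eval (pderiv f) a \<noteq> 0" using ex_simple_root[OF assms] by blast
  define F :: "'c poly" where "F = map_poly of_rat f"
  define H where "H = synthetic_div F a"
  have FH: "F = [:- a, 1:] * H"
    using synthetic_div_correct'[of a F] f(1) by (simp add: H_def F_def rat_eval_def)
  define D where "D = pderiv F"
  have D: "rat_eval (pderiv f) x = poly D x" for x by (simp add: D_def F_def rat_eval_def pderiv_map_poly_of_rat)
  \<comment> \<open>From \<open>F = (X - a) H\<close> the quotient \<open>F / D\<close> equals
    \<open>(x - a) H / D\<close>, and \<open>H / D\<close> is close to 1 near \<open>a\<close>
    because \<open>H\<close> and \<open>D\<close> agree there.\<close>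
  have Da: "poly D a = poly H a"
    unfolding D_def FH pderiv_mult by (simp add: pderiv_pCons)
  define c where "c = nabs (poly D a)"
  have "c > 0" using f(2) by (simp add: c_def D)
  obtain r1 where r1: "r1 > 0" "\<And>x. nabs (x - a) \<le> r1 \<Longrightarrow> nabs (poly D x - poly D a) < c"
    using poly_continuous[OF \<open>c > 0\<close>] by blast
  obtain r2 where r2: "r2 > 0" "\<And>x. nabs (x - a) \<le> r2 \<Longrightarrow> nabs (poly H x - poly D a) < c"
    using poly_continuous[OF \<open>c > 0\<close>] unfolding Da by blast
  have "poly D x \<noteq> 0 \<and> nabs (poly F x / poly D x - (x - a)) < nabs (x - a)"
    if x: "x \<noteq> a" "nabs (x - a) \<le> min r1 r2" for x
  proof -
    have Dx: "nabs (poly D x) = c" using nabs_eqI[of "poly D x" "poly D a"] r1(2) x by (simp add: c_def)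
    then have nz: "poly D x \<noteq> 0" using \<open>c > 0\<close> by auto
    have "nabs (poly H x - poly D x) < c"
      using nabs_diff_trans_less[of "poly H x" "poly D a" c "poly D x"] r1(2)[of x] r2(2)[of x] x
      by (simp add: nabs_diff_commute)
    then have "nabs (x - a) * nabs (poly H x - poly D x) / c < nabs (x - a)"
      using x(1) \<open>c > 0\<close> by (simp add: field_simps)
    moreover have "poly F x / poly D x - (x - a) = (x - a) * (poly H x - poly D x) / poly D x"
      using nz by (simp add: FH field_simps)
    ultimately show ?thesis using nz Dx by (simp add: nabs_divide nabs_mult)
  qed
  then show ?thesis
    using r1(1) r2(1) by (intro exI[of _ f] exI[of _ "pderiv f"] exI[of _ "min r1 r2"])
      (auto simp: D[symmetric] F_def rat_eval_def[symmetric])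
qed

lemma nabs_complete:
  fixes f :: "nat \<Rightarrow> 'c"
  assumes "\<And>\<epsilon>. \<epsilon> > 0 \<Longrightarrow> \<exists>N. \<forall>m\<ge>N. \<forall>n\<ge>N. nabs (f m - f n) < \<epsilon>"
  shows "\<exists>x. \<forall>\<epsilon>>0. \<exists>N. \<forall>n\<ge>N. nabs (f n - x) < \<epsilon>"
proof -
  interpret M: Metric_space UNIV "val_dist v" by (rule Metric_space_val_dist)
  have "M.mcomplete" using completion_Cp by (simp add: is_completion_def)
  moreover have "M.MCauchy f" unfolding M.MCauchy_def val_dist_eq using assms by auto
  ultimately obtain x where "limitin M.mtopology f x sequentially" unfolding M.mcomplete_def by blast
  then show ?thesis unfolding M.limit_metric_sequentially val_dist_eq by auto
qed

text \<open>This allows the terms of the series to be multiples of prescribed elements and still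
  arbitrarily small.\<close>

lemma ex_p_multiple_small:
  assumes "\<epsilon> > 0" shows "\<exists>N. nabs (of_nat p ^ N * b) < \<epsilon>"
proof -
  have p0: "(of_nat p :: 'c) \<noteq> 0" using prime_p by auto
  have "nabs (of_nat p) = exp (- 1)" using p0 by (simp add: nabs_eq val_p)
  then have p: "nabs (of_nat p) < 1" by simp
  obtain N where "nabs (of_nat p) ^ N < \<epsilon> / (nabs b + 1)"
    using real_arch_pow_inv[of "\<epsilon> / (nabs b + 1)" "nabs (of_nat p)"] p assms
    by (auto simp: add_nonneg_pos)
  then have "nabs (of_nat p) ^ N * (nabs b + 1) < \<epsilon>"
    by (simp add: pos_less_divide_eq add_nonneg_pos)
  moreover have "nabs (of_nat p) ^ N * nabs b \<le> nabs (of_nat p) ^ N * (nabs b + 1)"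
    by (intro mult_left_mono) auto
  ultimately show ?thesis by (auto simp: nabs_mult nabs_power intro!: exI[of _ N])
qed

text \<open>
  Each term of the series is small enough that Newton's quotient at the partial sum before it is
  valid at the limit, and that the limit differs from one further algebraic number.
\<close>

lemma ex_generic_point:
  assumes L: "subring_set L" "\<rat> \<subseteq> L" "L \<subseteq> {x. algebraic x}"
  obtains \<alpha> where "\<not> algebraic \<alpha>" "\<And>\<epsilon>. \<epsilon> > 0 \<Longrightarrow> \<exists>a\<in>L. nabs (\<alpha> - a) < \<epsilon>"
    and "\<And>x. x \<in> L \<Longrightarrow> x \<noteq> 0 \<Longrightarrow> \<exists>f g. rat_eval g \<alpha> \<noteq> 0 \<and> nabs (rat_eval f \<alpha> / rat_eval g \<alpha> - x) < nabs x"
proof -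
  have p0: "(of_nat p :: 'c) \<noteq> 0" using prime_p by auto
  have pL: "of_nat p ^ N \<in> L" for N using L(2) by (intro subsetD[OF L(2)]) simp
  define b where "b = from_nat_into (L - {0})"
  define e :: "nat \<Rightarrow> 'c" where "e = from_nat_into {x. algebraic x}"
  have "1 \<in> L - {0}" using subring_set_1[OF L(1)] by simp
  then have "L - {0} \<noteq> {}" by blast
  moreover have "countable (L - {0})" using countable_subset[OF L(3) countable_algebraic] by simp
  ultimately have b: "range b = L - {0}" unfolding b_def by (rule range_from_nat_into)
  have "{x :: 'c. algebraic x} \<noteq> {}" using algebraic_0 by blast
  then have e: "range e = {x. algebraic x}" unfolding e_def by (rule range_from_nat_into[OF _ countable_algebraic])
  have bL: "b i \<in> L" "b i \<noteq> 0" for i using b by auto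
  \<comment> \<open>A state consists of a partial sum and the next term. The clauses after the shape
    of the term keep the limit away from \<open>e i\<close> and within the radius of a Newton
    quotient at the partial sum.\<close>
  define P where "P i s \<longleftrightarrow> fst s \<in> L \<and> (\<exists>N. snd s = of_nat p ^ N * b i) \<and>
      (e i \<noteq> fst s \<longrightarrow> nabs (snd s) < nabs (e i - fst s)) \<and>
      (\<exists>f g. \<forall>x. x \<noteq> fst s \<longrightarrow> nabs (x - fst s) \<le> nabs (snd s) \<longrightarrow>
        rat_eval g x \<noteq> 0 \<and> nabs (rat_eval f x / rat_eval g x - (x - fst s)) < nabs (x - fst s))" for i s
  have step: "\<exists>c. P i (a, c) \<and> nabs c < \<epsilon>" if a: "a \<in> L" and \<epsilon>: "\<epsilon> > 0" for i a \<epsilon>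
  proof -
    have "algebraic a" using a L(3) by blast
    from newton_quotient[OF this] obtain f g r where fg: "r > 0" "\<forall>x. x \<noteq> a \<longrightarrow> nabs (x - a) \<le> r \<longrightarrow>
      rat_eval g x \<noteq> 0 \<and> nabs (rat_eval f x / rat_eval g x - (x - a)) < nabs (x - a)" by blast
    \<comment> \<open>The bounds come from the Newton quotient, the prescribed decay and the
      distance to \<open>e i\<close>. The value 1 is a default for \<open>e i = a\<close>, a point
      avoided anyway because the limit stays at positive distance from the partial sum.\<close>
    define \<delta> where "\<delta> = min r (min \<epsilon> (if e i \<noteq> a then nabs (e i - a) else 1))"
    have "\<delta> > 0" using fg(1) \<epsilon> by (simp add: \<delta>_def)
    then obtain N where N: "nabs (of_nat p ^ N * b i) < \<delta>" using ex_p_multiple_small by blast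
    have "P i (a, of_nat p ^ N * b i)"
      unfolding P_def fst_conv snd_conv
    proof (intro conjI)
      show "\<exists>f g. \<forall>x. x \<noteq> a \<longrightarrow> nabs (x - a) \<le> nabs (of_nat p ^ N * b i) \<longrightarrow>
        rat_eval g x \<noteq> 0 \<and> nabs (rat_eval f x / rat_eval g x - (x - a)) < nabs (x - a)"
        using N fg(2) by (intro exI[of _ f] exI[of _ g]) (auto simp: \<delta>_def)
    qed (use a N in \<open>auto simp: \<delta>_def\<close>)
    then show ?thesis using N by (auto simp: \<delta>_def)
  qed
  \<comment> \<open>Halving gives convergence and also makes each term dominate its tail.\<close>
  have "\<exists>s. \<forall>n. P n (s n) \<and> (fst (s (Suc n)) = fst (s n) + snd (s n) \<and> nabs (snd (s (Suc n))) < nabs (snd (s n)) / 2)"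
  proof (rule dependent_nat_choice)
    show "\<exists>s. P 0 s" using step[OF subring_set_0[OF L(1)], of 1 0] by auto
    fix s n assume s: "P n s"
    then obtain N where N: "snd s = of_nat p ^ N * b n" by (auto simp: P_def)
    then have "fst s + snd s \<in> L"
      using s bL pL by (auto simp: P_def intro!: subring_set_add[OF L(1)] subring_set_mult[OF L(1)])
    moreover have "nabs (snd s) / 2 > 0" using N bL p0 by simp
    ultimately obtain c where "P (Suc n) (fst s + snd s, c)" "nabs c < nabs (snd s) / 2"
      using step by blast
    then show "\<exists>t. P (Suc n) t \<and> (fst t = fst s + snd s \<and> nabs (snd t) < nabs (snd s) / 2)"
      by (intro exI[of _ "(fst s + snd s, c)"]) simp
  qed
  then obtain s where s: "\<And>n. P n (s n)" "\<And>n. fst (s (Suc n)) = fst (s n) + snd (s n)"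
    "\<And>n. nabs (snd (s (Suc n))) < nabs (snd (s n)) / 2" by blast
  define a where "a n = fst (s n)" for n
  define c where "c n = snd (s n)" for n
  have a_Suc: "a (Suc n) = a n + c n" and c_Suc: "nabs (c (Suc n)) < nabs (c n) / 2" for n
    using s by (simp_all add: a_def c_def)
  have aL: "a n \<in> L" for n using s(1)[of n] by (simp add: P_def a_def)
  have c_power: "nabs (c n) \<le> nabs (c 0) / 2 ^ n" for n
  proof (induction n)
    case (Suc n)
    then show ?case using c_Suc[of n] by simp
  qed simp
  have c_small: "\<exists>N. nabs (c N) < \<epsilon>" if \<epsilon>: "\<epsilon> > 0" for \<epsilon>
  proof -
    have "nabs (c 0) + 1 > 0" by (simp add: add_nonneg_pos)
    then obtain N where "(1 / 2) ^ N < \<epsilon> / (nabs (c 0) + 1)"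
      using real_arch_pow_inv[of "\<epsilon> / (nabs (c 0) + 1)" "1/2"] \<epsilon> by auto
    then have "(nabs (c 0) + 1) / 2 ^ N < \<epsilon>"
      using \<open>nabs (c 0) + 1 > 0\<close> by (simp add: field_simps)
    moreover have "nabs (c 0) / 2 ^ N \<le> (nabs (c 0) + 1) / 2 ^ N" by (intro divide_right_mono) auto
    ultimately show ?thesis using c_power[of N] by (intro exI[of _ N]) linarith
  qed
  have a_diff: "nabs (a m - a n) \<le> nabs (c n)" if "n \<le> m" for m n
    using that
  proof (induction m rule: dec_induct)
    case (step m)
    have "nabs (c m) \<le> nabs (c n)"
      using step(1)
    proof (induction m rule: dec_induct)
      case (step m)
      then show ?case using c_Suc[of m] nabs_nonneg[of "c m"] by linarith
    qed simp
    then show ?case using nabs_add_le[OF step.IH, of "c m"] by (simp add: a_Suc algebra_simps)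
  qed simp
  have "\<exists>N. \<forall>m\<ge>N. \<forall>n\<ge>N. nabs (a m - a n) < \<epsilon>" if \<epsilon>: "\<epsilon> > 0" for \<epsilon>
  proof -
    obtain N where N: "nabs (c N) < \<epsilon>" using c_small[OF \<epsilon>] by blast
    have "nabs (a m - a n) < \<epsilon>" if "m \<ge> N" "n \<ge> N" for m n
      using nabs_diff_trans_less[of "a m" "a N" \<epsilon> "a n"] a_diff[OF that(1)] a_diff[OF that(2)] N
      by (simp add: nabs_diff_commute)
    then show ?thesis by blast
  qed
  then obtain \<alpha> where \<alpha>: "\<forall>\<epsilon>>0. \<exists>N. \<forall>n\<ge>N. nabs (a n - \<alpha>) < \<epsilon>" using nabs_complete[of a] by blast
  have c0: "c n \<noteq> 0" for n using s(1)[of n] bL p0 by (auto simp: P_def c_def)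
  have \<alpha>_le: "nabs (\<alpha> - a n) \<le> nabs (c n)" for n
  proof -
    obtain N where N: "\<forall>m\<ge>N. nabs (a m - \<alpha>) < nabs (c n)" using \<alpha> c0[of n] by force
    then have "nabs (\<alpha> - a (max N n)) < nabs (c n)" by (simp add: nabs_diff_commute)
    then show ?thesis
      using nabs_add_le[of "\<alpha> - a (max N n)" "nabs (c n)" "a (max N n) - a n"] a_diff[of n "max N n"] by simp
  qed
  \<comment> \<open>Hence a Newton quotient close to \<alpha> - a n is equally close to the single
    term \<open>c n\<close>.\<close>
  have tail: "nabs (\<alpha> - a n - c n) < nabs (c n)" for n
  proof -
    have eq: "\<alpha> - a n - c n = \<alpha> - a (Suc n)" by (simp add: a_Suc)
    show ?thesis
      unfolding eq using \<alpha>_le[of "Suc n"] c_Suc[of n] nabs_nonneg[of "c (Suc n)"] by linarith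
  qed
  then have \<alpha>_eq: "nabs (\<alpha> - a n) = nabs (c n)" for n using nabs_eqI by blast
  \<comment> \<open>The limit is at distance exactly \<open>nabs (c n)\<close> from
    \<open>a n\<close>, while \<open>e n\<close> is at distance 0 or at a larger one.\<close>
  have "\<alpha> \<noteq> e n" for n
  proof (cases "e n = a n")
    case True
    then show ?thesis using \<alpha>_eq[of n] c0[of n] by auto
  next
    case False
    then show ?thesis using \<alpha>_eq[of n] s(1)[of n] by (auto simp: P_def a_def c_def)
  qed
  then have "\<not> algebraic \<alpha>" using e by blast
  moreover have "\<exists>a\<in>L. nabs (\<alpha> - a) < \<epsilon>" if "\<epsilon> > 0" for \<epsilon>
    using c_small[OF that] \<alpha>_eq aL by metis
  moreover have "\<exists>f g. rat_eval g \<alpha> \<noteq> 0 \<and> nabs (rat_eval f \<alpha> / rat_eval g \<alpha> - x) < nabs x"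
    if "x \<in> L" "x \<noteq> 0" for x
  proof -
    obtain n where n: "x = b n" using b \<open>x \<in> L\<close> \<open>x \<noteq> 0\<close> by blast
    obtain N where N: "c n = of_nat p ^ N * x" using s(1)[of n] by (auto simp: P_def c_def n)
    have "\<alpha> \<noteq> a n" using \<alpha>_eq[of n] c0[of n] by auto
    then obtain f g where fg: "rat_eval g \<alpha> \<noteq> 0"
      "nabs (rat_eval f \<alpha> / rat_eval g \<alpha> - (\<alpha> - a n)) < nabs (\<alpha> - a n)"
      using s(1)[of n] \<alpha>_eq[of n] unfolding P_def a_def c_def by (metis order_refl)
    \<comment> \<open>Moving the rational factor \<open>p ^ N\<close> into the denominator turns an
      approximation of \<open>c n\<close> into one of \<open>x\<close>.\<close>
    define h where "h = smult (of_nat p ^ N) g"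
    have h: "rat_eval h \<alpha> = of_nat p ^ N * rat_eval g \<alpha>"
      by (simp add: h_def rat_eval_smult of_rat_power)
    have "nabs (rat_eval f \<alpha> / rat_eval g \<alpha> - of_nat p ^ N * x) < nabs (of_nat p ^ N) * nabs x"
      using nabs_diff_trans_less[OF fg(2)[unfolded \<alpha>_eq] tail] by (simp add: N nabs_mult)
    also have "rat_eval f \<alpha> / rat_eval g \<alpha> - of_nat p ^ N * x = of_nat p ^ N * (rat_eval f \<alpha> / rat_eval h \<alpha> - x)"
      using p0 fg(1) by (simp add: h field_simps)
    finally have "nabs (rat_eval f \<alpha> / rat_eval h \<alpha> - x) < nabs x"
      using p0 by (simp add: nabs_mult)
    then show ?thesis using h p0 fg(1) by (intro exI[of _ f] exI[of _ h]) simp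
  qed
  ultimately show ?thesis by (rule that)
qed

end

subsection \<open>The valuation ring at the point\<close>

context
  fixes \<alpha> :: "'c::field_char_0"
  assumes transcendental: "\<not> algebraic \<alpha>"
begin

lemma rat_eval_eq_0_iff: "rat_eval f \<alpha> = 0 \<longleftrightarrow> f = 0"
  using algebraic_rat_eval[of f \<alpha>] transcendental by auto

lemma ratfun_defined_at_transcendental: "ratfun_defined_at \<phi> \<alpha>"
  using rat_eval_eq_0_iff[of "snd (quot_of_fract \<phi>)"] by (simp add: ratfun_defined_at_def rat_eval_def)

text \<open>Evaluation uses lowest terms; cross multiplication transfers it to any fraction, as no
  nonzero denominator vanishes at a transcendental point.\<close>

lemma ratfun_eval_Fract:
  assumes "g \<noteq> 0" shows "ratfun_eval (Fract f g) \<alpha> = rat_eval f \<alpha> / rat_eval g \<alpha>"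
proof -
  define n d where "n = fst (quot_of_fract (Fract f g))" and "d = snd (quot_of_fract (Fract f g))"
  have "d \<noteq> 0" by (simp add: d_def)
  have "Fract n d = Fract f g" by (simp add: n_def d_def)
  then have "n * g = f * d" using eq_fract(1)[OF \<open>d \<noteq> 0\<close> assms] by simp
  then have "rat_eval n \<alpha> * rat_eval g \<alpha> = rat_eval f \<alpha> * rat_eval d \<alpha>"
    by (metis rat_eval_mult)
  moreover have "rat_eval d \<alpha> \<noteq> 0" "rat_eval g \<alpha> \<noteq> 0" using \<open>d \<noteq> 0\<close> assms by (simp_all add: rat_eval_eq_0_iff)
  ultimately have "rat_eval n \<alpha> / rat_eval d \<alpha> = rat_eval f \<alpha> / rat_eval g \<alpha>" by (simp add: field_simps)
  then show ?thesis by (simp add: ratfun_eval_def rat_eval_def n_def d_def)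
qed

lemma ratfun_eval_add: "ratfun_eval (\<phi> + \<psi>) \<alpha> = ratfun_eval \<phi> \<alpha> + ratfun_eval \<psi> \<alpha>"
proof -
  obtain a b c d where "\<phi> = Fract a b" "b \<noteq> 0" "\<psi> = Fract c d" "d \<noteq> 0"
    by (metis Fract_cases)
  then show ?thesis
    by (simp add: ratfun_eval_Fract rat_eval_add rat_eval_mult rat_eval_eq_0_iff field_simps)
qed

lemma ratfun_eval_mult: "ratfun_eval (\<phi> * \<psi>) \<alpha> = ratfun_eval \<phi> \<alpha> * ratfun_eval \<psi> \<alpha>"
proof -
  obtain a b c d where "\<phi> = Fract a b" "b \<noteq> 0" "\<psi> = Fract c d" "d \<noteq> 0"
    by (metis Fract_cases)
  then show ?thesis by (simp add: ratfun_eval_Fract rat_eval_mult)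
qed

lemma ratfun_eval_1 [simp]: "ratfun_eval 1 \<alpha> = 1"
  by (simp add: One_fract_def ratfun_eval_Fract)

lemma ratfun_eval_0 [simp]: "ratfun_eval 0 \<alpha> = 0"
  by (simp add: Zero_fract_def ratfun_eval_Fract)

lemma ratfun_eval_uminus: "ratfun_eval (- \<phi>) \<alpha> = - ratfun_eval \<phi> \<alpha>"
  using ratfun_eval_add[of \<phi> "- \<phi>"] by (simp add: eq_neg_iff_add_eq_0 add.commute)

lemma ratfun_eval_inverse: "ratfun_eval (inverse \<phi>) \<alpha> = inverse (ratfun_eval \<phi> \<alpha>)"
proof (cases "\<phi> = 0")
  case False
  then have "ratfun_eval (inverse \<phi>) \<alpha> * ratfun_eval \<phi> \<alpha> = 1"
    using ratfun_eval_mult[of "inverse \<phi>" \<phi>] by simp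
  then show ?thesis by (metis inverse_unique mult.commute)
qed simp

lemma ratfun_eval_eq_0_iff: "ratfun_eval \<phi> \<alpha> = 0 \<longleftrightarrow> \<phi> = 0"
proof
  obtain a b where "\<phi> = Fract a b" "b \<noteq> 0" by (metis Fract_cases)
  moreover assume "ratfun_eval \<phi> \<alpha> = 0"
  ultimately show "\<phi> = 0" by (simp add: ratfun_eval_Fract rat_eval_eq_0_iff eq_fract Zero_fract_def)
qed simp

end

section \<open>Value group and residue field at the generic point\<close>

context prescribed_extension
begin

context
  fixes \<alpha> :: 'c and L :: "'c set" and S :: "('c \<times> 'k) set"
  assumes transcendental: "\<not> algebraic \<alpha>"
    and tower: "tower L S" "Range S = carrier k" "v ` (L - {0}) = real_group"
    and near: "\<And>\<epsilon>. \<epsilon> > 0 \<Longrightarrow> \<exists>a\<in>L. nabs (\<alpha> - a) < \<epsilon>"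
    and generic: "\<And>x. x \<in> L \<Longrightarrow> x \<noteq> 0 \<Longrightarrow>
      \<exists>f g. rat_eval g \<alpha> \<noteq> 0 \<and> nabs (rat_eval f \<alpha> / rat_eval g \<alpha> - x) < nabs x"
begin

lemma L_facts:
  shows "\<rat> \<subseteq> L" "subring_set L" "residue_relation v k S" "Domain S = {x \<in> L. nabs x \<le> 1}"
    and "x \<in> L \<Longrightarrow> x \<noteq> 0 \<Longrightarrow> \<exists>y\<in>L. nabs (x * y) = 1"
  using tower(1) by (auto simp: tower_def)

interpretation residue_relation v k S by (rule L_facts(3))

text \<open>By transcendence the value at \<alpha> is nonzero, so continuity provides a relative
  approximation by \<open>f(a)\<close> with \<open>a\<close> in \<open>L\<close>.\<close>

lemma rat_eval_near:
  assumes "f \<noteq> 0"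
  shows "\<exists>x\<in>L. nabs (rat_eval f \<alpha> - x) < nabs (rat_eval f \<alpha>)"
proof -
  have "nabs (rat_eval f \<alpha>) > 0" using rat_eval_eq_0_iff[OF transcendental] assms by simp
  then obtain \<delta> where \<delta>: "\<delta> > 0"
    "\<forall>x. nabs (x - \<alpha>) \<le> \<delta> \<longrightarrow> nabs (rat_eval f x - rat_eval f \<alpha>) < nabs (rat_eval f \<alpha>)"
    unfolding rat_eval_def using poly_continuous by blast
  obtain a where "a \<in> L" "nabs (\<alpha> - a) < \<delta>" using near[OF \<delta>(1)] by blast
  then show ?thesis
    using \<delta>(2) rat_eval_in_subring[OF L_facts(2,1)] by (metis less_imp_le nabs_diff_commute)
qed

lemma generic_ratfun:
  assumes "x \<in> L" "x \<noteq> 0" shows "\<exists>\<phi>. nabs (ratfun_eval \<phi> \<alpha> - x) < nabs x"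
proof -
  obtain f g where fg: "rat_eval g \<alpha> \<noteq> 0" "nabs (rat_eval f \<alpha> / rat_eval g \<alpha> - x) < nabs x"
    using generic[OF assms] by blast
  then have "g \<noteq> 0" by auto
  then show ?thesis using fg ratfun_eval_Fract[OF transcendental] by metis
qed

text \<open>Relative approximation preserves values in both directions: numerators and denominators
  are approximated from \<open>L\<close>, elements of \<open>L\<close> by rational
  functions.\<close>

lemma value_group_eq: "value_group_at v \<alpha> = real_group"
proof
  show "value_group_at v \<alpha> \<subseteq> real_group"
  proof
    fix \<gamma> assume "\<gamma> \<in> value_group_at v \<alpha>"
    then obtain \<phi> where \<phi>: "\<phi> \<noteq> 0" "\<gamma> = v (ratfun_eval \<phi> \<alpha>)" by (auto simp: value_group_at_def)
    obtain f g where fg: "\<phi> = Fract f g" "g \<noteq> 0" by (metis Fract_cases)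
    have "f \<noteq> 0" using \<phi>(1) fg by (auto simp: Zero_fract_def eq_fract)
    have in_group: "v (rat_eval h \<alpha>) \<in> real_group" if h: "h \<noteq> 0" for h
    proof -
      obtain x where x: "x \<in> L" "nabs (rat_eval h \<alpha> - x) < nabs (rat_eval h \<alpha>)"
        using rat_eval_near[OF h] by blast
      have nz: "rat_eval h \<alpha> \<noteq> 0" using rat_eval_eq_0_iff[OF transcendental] h by simp
      have eq: "nabs x = nabs (rat_eval h \<alpha>)" using nabs_eqI[of x "rat_eval h \<alpha>"] x(2) by (simp add: nabs_diff_commute[of x])
      then have "x \<noteq> 0" using nz nabs_eq_0_iff by metis
      then have "v (rat_eval h \<alpha>) = v x" using eq nz nabs_eq_iff by metis
      then show ?thesis using tower(3) x(1) \<open>x \<noteq> 0\<close> by blast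
    qed
    have "\<gamma> = v (rat_eval f \<alpha>) - v (rat_eval g \<alpha>)"
      using \<phi>(2) fg \<open>f \<noteq> 0\<close> ratfun_eval_Fract[OF transcendental] rat_eval_eq_0_iff[OF transcendental]
      by (simp add: val_divide)
    then show "\<gamma> \<in> real_group" using real_group_diff in_group fg \<open>f \<noteq> 0\<close> by simp
  qed
  show "real_group \<subseteq> value_group_at v \<alpha>"
  proof
    fix \<gamma> assume "\<gamma> \<in> real_group"
    then obtain x where x: "x \<in> L" "x \<noteq> 0" "\<gamma> = v x" using tower(3) by blast
    obtain \<phi> where \<phi>: "nabs (ratfun_eval \<phi> \<alpha> - x) < nabs x" using generic_ratfun x by blast
    then have eq: "nabs (ratfun_eval \<phi> \<alpha>) = nabs x" by (rule nabs_eqI)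
    then have nz: "ratfun_eval \<phi> \<alpha> \<noteq> 0" using x(2) nabs_eq_0_iff by metis
    then have "v (ratfun_eval \<phi> \<alpha>) = \<gamma>" using eq x nabs_eq_iff by metis
    moreover have "\<phi> \<noteq> 0" using nz ratfun_eval_0[OF transcendental] by auto
    ultimately show "\<gamma> \<in> value_group_at v \<alpha>" by (auto simp: value_group_at_def)
  qed
qed

text \<open>
  Since residues are torsion, a power of a unit of \<open>L\<close> is congruent to its inverse, so quotients
  can be approximated although \<open>L\<close> need not be closed under division.
\<close>

lemma ratfun_near:
  assumes le: "nabs (ratfun_eval \<phi> \<alpha>) \<le> 1"
  shows "\<exists>x\<in>Domain S. nabs (ratfun_eval \<phi> \<alpha> - x) < 1"
proof (cases "\<phi> = 0")
  case True
  then show ?thesis using rel_zero ratfun_eval_0[OF transcendental] by (intro bexI[of _ 0]) auto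
next
  case False
  obtain F G where FG: "\<phi> = Fract F G" "G \<noteq> 0" by (metis Fract_cases)
  have "F \<noteq> 0" using False FG by (auto simp: Zero_fract_def eq_fract)
  define f g where "f = rat_eval F \<alpha>" and "g = rat_eval G \<alpha>"
  have nz: "f \<noteq> 0" "g \<noteq> 0"
    using \<open>F \<noteq> 0\<close> FG rat_eval_eq_0_iff[OF transcendental] by (simp_all add: f_def g_def)
  have \<phi>: "ratfun_eval \<phi> \<alpha> = f / g"
    using FG ratfun_eval_Fract[OF transcendental] by (simp add: f_def g_def)
  obtain x where x: "x \<in> L" "nabs (f - x) < nabs f" using rat_eval_near[OF \<open>F \<noteq> 0\<close>] by (auto simp: f_def)
  obtain y where y: "y \<in> L" "nabs (g - y) < nabs g" using rat_eval_near[OF FG(2)] by (auto simp: g_def)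
  have xf: "nabs x = nabs f" using nabs_eqI[of x f] x(2) by (simp add: nabs_diff_commute[of x f])
  have yg: "nabs y = nabs g" using nabs_eqI[of y g] y(2) by (simp add: nabs_diff_commute[of y g])
  have nz': "x \<noteq> 0" "y \<noteq> 0" using xf yg nz nabs_eq_0_iff by metis+
  obtain z where z: "z \<in> L" "nabs (y * z) = 1" using L_facts(5) y(1) nz'(2) by blast
  define u where "u = y * z"
  have u: "u \<in> L" "nabs u = 1" using y z subring_set_mult[OF L_facts(2)] by (auto simp: u_def)
  then have "u \<in> Domain S" using L_facts(4) by simp
  then obtain s where s: "(u, s) \<in> S" by blast
  then have "s \<noteq> \<zero>" using rel_zero_iff u(2) by fastforce
  then obtain N :: nat where N: "N > 0" "s [^] N = \<one>" using torsion rel_carrier[OF s] by blast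
  have "(u ^ N - 1, \<zero>) \<in> S"
    using rel_diff[OF rel_power[OF s, of N] rel_one] N by (simp add: k.minus_eq k.r_neg)
  then have uN: "nabs (u ^ N - 1) < 1" using rel_zero_iff by blast
  \<comment> \<open>Since \<open>x / y = x * z / u\<close> and \<open>u ^ N\<close> is congruent to
    1, the power \<open>u ^ (N - 1)\<close> takes the place of the inverse of
    \<open>u\<close>.\<close>
  define w where "w = x * z * u ^ (N - 1)"
  have "w \<in> L" unfolding w_def using x z u
    by (intro subring_set_mult[OF L_facts(2)] subring_set_power[OF L_facts(2)]) auto
  have "u ^ N = y * z * u ^ (N - 1)" using N(1) by (simp add: u_def power_eq_if)
  then have "x / y - w = x / y * (1 - u ^ N)" using nz' by (simp add: w_def field_simps)
  moreover have "nabs (x / y) \<le> 1" using le by (simp add: \<phi> nabs_divide xf yg)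
  then have "nabs (x / y) * nabs (1 - u ^ N) < 1"
    using uN mult_right_mono[of "nabs (x / y)" 1 "nabs (1 - u ^ N)"] by (simp add: nabs_diff_commute)
  ultimately have 1: "nabs (x / y - w) < 1" by (simp only: nabs_mult)
  have "nabs ((f - x) * y) < nabs f * nabs g" "nabs (x * (y - g)) < nabs f * nabs g"
    using x y nz by (simp_all add: nabs_mult xf yg nabs_diff_commute)
  then have "nabs ((f - x) * y + x * (y - g)) < nabs f * nabs g" by (rule nabs_add_less)
  moreover have "f / g - x / y = ((f - x) * y + x * (y - g)) / (g * y)"
    using nz nz' by (simp add: field_simps)
  ultimately have "nabs (f / g - x / y) < (nabs f * nabs g) / (nabs g * nabs g)"
    using nz by (simp only: nabs_divide nabs_mult yg) (intro divide_strict_right_mono, auto)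
  also have "\<dots> \<le> 1" using le nz by (simp add: \<phi> nabs_divide)
  finally have near_w: "nabs (f / g - w) < 1" using 1 nabs_diff_trans_less by blast
  have "nabs w \<le> 1"
    using nabs_add_le[of "w - f / g" 1 "f / g"] near_w le \<phi> by (simp add: nabs_diff_commute)
  then have "w \<in> Domain S" using L_facts(4) \<open>w \<in> L\<close> by blast
  then show ?thesis using near_w \<phi> by auto
qed

text \<open>\<open>h\<close> assigns to \<phi> the residue of any integral element of
  \<open>L\<close> congruent to its value at \<alpha>, which exists by \<open>ratfun_near\<close>.
  Its kernel consists of the non-units, and it is onto because lifts of nonzero residues are
  approximated by rational functions.\<close>

lemma residue_field_eq: "residue_field (val_ring_at v \<alpha>) \<simeq> k"
proof -
  define E where "E \<phi> = ratfun_eval \<phi> \<alpha>" for \<phi>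
  have E: "E (\<phi> + \<psi>) = E \<phi> + E \<psi>" "E (\<phi> * \<psi>) = E \<phi> * E \<psi>" "E (- \<phi>) = - E \<phi>"
    "E 0 = 0" "E 1 = 1" "E (inverse \<phi>) = inverse (E \<phi>)" "E \<phi> = 0 \<longleftrightarrow> \<phi> = 0" for \<phi> \<psi>
    using transcendental by (simp_all add: E_def ratfun_eval_add ratfun_eval_mult ratfun_eval_uminus
      ratfun_eval_inverse ratfun_eval_eq_0_iff)
  define C where "C = {\<phi>. nabs (E \<phi>) \<le> 1}"
  define R where "R = (ring_of_type_algebra :: rat poly fract ring)"
  define V where "V = R\<lparr>carrier := C\<rparr>"
  note R_simps = type_ring_simps[where 'c = "rat poly fract", folded R_def]
  note R_uminus = type_ring_uminus[where 'c = "rat poly fract", folded R_def]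
  have V: "val_ring_at v \<alpha> = V"
    unfolding val_ring_at_def V_def R_def C_def E_def integral_elts_def
    using ratfun_defined_at_transcendental[OF transcendental] nabs_le_1_iff
    by (auto intro!: arg_cong[where f = "\<lambda>C. _\<lparr>carrier := C\<rparr>"]) (metis nabs_0 zero_le_one)+
  interpret R: field R unfolding R_def by (rule field_from_type_algebra)
  have "subring C R"
    by (rule R.subringI)
      (auto simp: R_simps R_uminus C_def E nabs_mult intro: nabs_add_le mult_le_one)
  then interpret V: ring V unfolding V_def by (rule R.subring_is_ring)
  have V_simps: "carrier V = C" "x \<otimes>\<^bsub>V\<^esub> y = x * y" "x \<oplus>\<^bsub>V\<^esub> y = x + y" "\<one>\<^bsub>V\<^esub> = 1" "\<zero>\<^bsub>V\<^esub> = 0" for x y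
    by (simp_all add: V_def R_simps)
  interpret T: residue_relation v k "saturate UNIV S"
    by (rule residue_relation_saturate) (simp add: subring_set_def)
  define h where "h \<phi> = (THE s. (E \<phi>, s) \<in> saturate UNIV S)" for \<phi>
  have h_eq: "h \<phi> = s" if "(E \<phi>, s) \<in> saturate UNIV S" for \<phi> s
    unfolding h_def using that T.rel_unique[of "E \<phi>"] by (intro the_equality) auto
  have h: "(E \<phi>, h \<phi>) \<in> saturate UNIV S" if \<phi>: "\<phi> \<in> C" for \<phi>
  proof -
    obtain x where "x \<in> Domain S" "nabs (E \<phi> - x) < 1"
      using ratfun_near[of \<phi>] \<phi> by (auto simp: C_def E_def)
    then obtain s where s: "(E \<phi>, s) \<in> saturate UNIV S" by (auto simp: saturate_def)
    then show ?thesis using h_eq by simp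
  qed
  have hom: "h \<in> ring_hom V k"
  proof (rule ring_hom_memI)
    fix x y assume xy: "x \<in> carrier V" "y \<in> carrier V"
    then have *: "(E x, h x) \<in> saturate UNIV S" "(E y, h y) \<in> saturate UNIV S" using h by (auto simp: V_simps)
    show "h (x \<otimes>\<^bsub>V\<^esub> y) = h x \<otimes> h y"
      using T.rel_mult[OF *] by (intro h_eq) (simp add: V_simps E)
    show "h (x \<oplus>\<^bsub>V\<^esub> y) = h x \<oplus> h y"
      using T.rel_add[OF *] by (intro h_eq) (simp add: V_simps E)
  next
    show "h x \<in> carrier k" if "x \<in> carrier V" for x
      using h[of x] that T.rel_carrier by (auto simp: V_simps)
    show "h \<one>\<^bsub>V\<^esub> = \<one>" using T.rel_one by (intro h_eq) (simp add: V_simps E)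
  qed
  interpret h: ring_hom_ring V k h
    by (intro ring_hom_ringI2 V.ring_axioms k.ring_axioms hom)
  have units: "Units V = {\<phi> \<in> C. nabs (E \<phi>) = 1}"
  proof (intro equalityI subsetI)
    fix \<phi> assume "\<phi> \<in> Units V"
    then obtain \<psi> where *: "\<phi> \<in> C" "\<psi> \<in> C" "\<psi> * \<phi> = 1" by (auto simp: Units_def V_simps)
    have "nabs (E \<psi>) * nabs (E \<phi>) = 1" using * by (simp add: nabs_mult[symmetric] E(2)[symmetric] E(5))
    moreover have "nabs (E \<psi>) * nabs (E \<phi>) \<le> 1 * nabs (E \<phi>)"
      using * by (intro mult_right_mono) (auto simp: C_def)
    ultimately have "nabs (E \<phi>) = 1" using * by (simp add: C_def)
    then show "\<phi> \<in> {\<phi> \<in> C. nabs (E \<phi>) = 1}" using * by simp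
  next
    fix \<phi> assume \<phi>: "\<phi> \<in> {\<phi> \<in> C. nabs (E \<phi>) = 1}"
    then have "\<phi> \<noteq> 0" by (auto simp: E)
    moreover have "inverse \<phi> \<in> C" using \<phi> by (simp add: C_def E nabs_inverse)
    ultimately show "\<phi> \<in> Units V" using \<phi> by (auto simp: Units_def V_simps intro!: bexI[of _ "inverse \<phi>"])
  qed
  have "\<phi> \<in> carrier V - Units V \<longleftrightarrow> \<phi> \<in> a_kernel V k h" for \<phi>
    using T.rel_zero_iff[OF h, of \<phi>] unfolding a_kernel_def' units by (auto simp: V_simps C_def)
  then have "carrier V - Units V = a_kernel V k h" by blast
  moreover have "h ` carrier V = carrier k"
  proof
    show "h ` carrier V \<subseteq> carrier k" using h.hom_closed by blast
    show "carrier k \<subseteq> h ` carrier V"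
    proof
      fix s assume s: "s \<in> carrier k"
      show "s \<in> h ` carrier V"
      proof (cases "s = \<zero>")
        case True
        then show ?thesis using h.hom_zero V.zero_closed by (metis imageI)
      next
        case False
        obtain x where x: "(x, s) \<in> S" using s tower(2) by blast
        have "\<not> nabs x < 1" using rel_zero_iff[OF x] False by simp
        then have x1: "nabs x = 1" using rel_integral[OF x] by simp
        then have "x \<noteq> 0" by auto
        moreover have "x \<in> L" using x L_facts(4) by blast
        ultimately obtain \<phi> where \<phi>: "nabs (E \<phi> - x) < nabs x" using generic_ratfun by (auto simp: E_def)
        then have "nabs (E \<phi>) = 1" using nabs_eqI[OF \<phi>] x1 by simp
        then have "\<phi> \<in> C" by (simp add: C_def)
        moreover have "(E \<phi>, s) \<in> saturate UNIV S"
          unfolding saturate_def using \<phi> x unfolding x1 by blast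
        then have "h \<phi> = s" by (rule h_eq)
        ultimately show ?thesis by (intro image_eqI[of _ _ \<phi>]) (simp_all add: V_simps)
      qed
    qed
  qed
  ultimately show ?thesis
    using h.FactRing_iso by (simp add: residue_field_def V)
qed

end

lemma ex_transcendental_point:
  "\<exists>\<alpha>::'c. \<not> algebraic \<alpha> \<and> residue_field (val_ring_at v \<alpha>) \<simeq> k \<and> value_group_at v \<alpha> = of_rat ` \<Gamma>"
proof -
  obtain L S where tower: "tower L S" "Range S = carrier k" "v ` (L - {0}) = real_group"
    using ex_full_tower .
  have L: "subring_set L" "\<rat> \<subseteq> L" "L \<subseteq> {x. algebraic x}"
    using tower(1) by (auto simp: tower_def algebraic_closure_Q_def algebraic_elts_def)
  obtain \<alpha> where \<alpha>: "\<not> algebraic \<alpha>" "\<And>\<epsilon>. \<epsilon> > 0 \<Longrightarrow> \<exists>a\<in>L. nabs (\<alpha> - a) < \<epsilon>"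
    "\<And>x. x \<in> L \<Longrightarrow> x \<noteq> 0 \<Longrightarrow> \<exists>f g. rat_eval g \<alpha> \<noteq> 0 \<and> nabs (rat_eval f \<alpha> / rat_eval g \<alpha> - x) < nabs x"
    using ex_generic_point[OF L] by blast
  have "residue_field (val_ring_at v \<alpha>) \<simeq> k" by (rule residue_field_eq[OF \<alpha>(1) tower \<alpha>(2,3)])
  moreover have "value_group_at v \<alpha> = real_group" by (rule value_group_eq[OF \<alpha>(1) tower \<alpha>(2,3)])
  ultimately show ?thesis using \<alpha>(1) by (auto simp: real_group_def)
qed

end

theorem theorem2p26:
  fixes p :: nat
    and v :: "'c::field_char_0 \<Rightarrow> real" and Qp Qpbar :: "'c set"
    and k :: "('k, 'm) ring_scheme" and Fp :: "'k set"
    and \<Gamma> :: "rat set"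
  assumes "prime p"
    and "padic_complex_field p v Qp Qpbar"
    and "algebraic_extension_of_Fp p Fp k"
    and "additive_subgroup \<Gamma> ring_of_type_algebra" and "\<int> \<subseteq> \<Gamma>"
  shows "\<exists>\<alpha>::'c. \<not> algebraic \<alpha> \<and>
           residue_field (val_ring_at v \<alpha>) \<simeq> k \<and>
           value_group_at v \<alpha> = of_rat ` \<Gamma>"
proof -
  interpret padic_complex_field p v Qp Qpbar by fact
  have k: "field k" "subfield Fp k" "k\<lparr>carrier := Fp\<rparr> \<simeq> ZFact (int p)"
    and alg: "\<And>x. x \<in> carrier k \<Longrightarrow> (ring.algebraic k over Fp) x"
    using assms(3) by (auto simp: algebraic_extension_of_Fp_def)
  obtain g :: "int \<Rightarrow> 'k" where g: "g \<in> ring_hom \<Z> k" "\<And>n. g n = \<zero>\<^bsub>k\<^esub> \<longleftrightarrow> int p dvd n" "finite Fp"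
    using prime_field_hom[OF assms(1) k] by blast
  interpret k: field k by fact
  interpret \<Gamma>: additive_subgroup \<Gamma> "ring_of_type_algebra :: rat ring" by fact
  interpret \<Gamma>': abelian_group "ring_of_type_algebra :: rat ring"
    using ring_from_type_algebra by (rule ring.is_abelian_group)
  \<comment> \<open>Algebraicity of \<open>k\<close> over the finite field \<open>Fp\<close> enters
    as torsion of its nonzero elements.\<close>
  interpret prescribed_extension p v Qp Qpbar k \<Gamma> g
  proof
    show "a - b \<in> \<Gamma>" if "a \<in> \<Gamma>" "b \<in> \<Gamma>" for a b
      using \<Gamma>.a_closed[OF that(1), of "- b"] \<Gamma>.a_inv_closed[OF that(2)]
      by (simp add: type_ring_simps type_ring_uminus)
    show "\<exists>N>0. s [^]\<^bsub>k\<^esub> (N::nat) = \<one>\<^bsub>k\<^esub>" if "s \<in> carrier k" "s \<noteq> \<zero>\<^bsub>k\<^esub>" for s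
      using k.algebraic_over_finite_torsion[OF k(2) g(3) that(1) alg[OF that(1)] that(2)] .
  qed (use g assms(5) in auto)
  show ?thesis by (rule ex_transcendental_point)
qed

end
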